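(* Let $C$ be a unitary modular tensor category with defining number field $K_C$, and let $K_F$ be the Galois field obtained as the normal closure of the field generated over $\mathbb{Q}$ by the $F$ symbols of $C$. Suppose there is a gauge in which the $F$ symbols are unitary and $K_F$ is a totally real field or a CM field. Then for every $q\in\mathrm{Gal}(K_C)$ that acts trivially on the quantum dimensions (i.e. $q(d_a)=d_a$ for all anyons $a$), the Galois conjugate $q(C)$ is a unitary modular tensor category, and hence (choosing the total quantum dimension to be positive) defines a unitary TQFT.
   Context: A modular tensor category (MTC) $C$ (over $\mathbb{C}$, with finitely many simple objects $a,b,\dots$ called anyons, unit $\mathbf 1$, fusion rules $a\otimes b=\sum_c N_{ab}^c c$) is described, after choosing bases of the fusion spaces $V_{ab}^c$ with $\dim V_{ab}^c=N_{ab}^c$ (such a choice is called a gauge), by its $F$ symbols (associativity matrices), $R$ symbols (braiding matrices) and pivotal coefficients $\epsilon_a\in\{\pm1\}$. Gauges are taken such that all entries of $F$ and $R$ lie in a number field (such gauges always exist, and for a unitary MTC one can simultaneously have $F$ and $R$ unitary). The defining number field $K_C$ is the normal closure over $\mathbb{Q}$ of $\mathbb{Q}(F,R)$. For $q\in\mathrm{Gal}(K_C):=\mathrm{Gal}(K_C/\mathbb{Q})$, the Galois conjugate $q(C)$ is the MTC with the same anyons, the same fusion rules and the same $\epsilon_a$, and with data $q(F),q(R)$; the anyon $a$ then has quantum dimension $q(d_a)$. An MTC is unitary if there is a gauge in which all its $F$ and $R$ matrices are unitary and all quantum dimensions are positive. A $2+1$D TQFT is an MTC together with a choice of sign of the total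 quantum dimension $\mathcal{D}=\pm\sqrt{\sum_a d_a^2}$; a unitary MTC with $\mathcal{D}>0$ gives a unitary TQFT. A CM field is a totally imaginary quadratic extension of a totally real number field. *)

theory Defs
  imports "HOL-Analysis.Analysis" "HOL-Computational_Algebra.Computational_Algebra"
begin

section \<open>Number fields inside the complex numbers\<close>

definition complex_subfield :: "complex set \<Rightarrow> bool" where
  "complex_subfield K \<longleftrightarrow> 0 \<in> K \<and> 1 \<in> K \<and>
     (\<forall>x\<in>K. \<forall>y\<in>K. x + y \<in> K \<and> x * y \<in> K) \<and>
     (\<forall>x\<in>K. - x \<in> K \<and> inverse x \<in> K)"

definition field_generated :: "complex set \<Rightarrow> complex set" where
  "field_generated S = \<Inter>{K. complex_subfield K \<and> S \<subseteq> K}"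

definition number_field :: "complex set \<Rightarrow> bool" where
  "number_field K \<longleftrightarrow> complex_subfield K \<and>
     (\<exists>B. finite B \<and> B \<subseteq> K \<and>
        (\<forall>x\<in>K. \<exists>r :: complex \<Rightarrow> rat. x = (\<Sum>b\<in>B. of_rat (r b) * b)))"

definition normal_over_rat :: "complex set \<Rightarrow> bool" where
  "normal_over_rat K \<longleftrightarrow>
     (\<forall>p :: rat poly. irreducible p \<longrightarrow>
        (\<exists>x\<in>K. poly (map_poly of_rat p) x = 0) \<longrightarrow>
        (\<forall>x. poly (map_poly of_rat p) x = 0 \<longrightarrow> x \<in> K))"

text \<open>The normal closure over the rationals of an algebraic \<open>K\<close>, realised as the
  smallest normal subfield of the algebraically closed field of complex numbers containing \<open>K\<close>.\<close>

definition normal_closure_rat :: "complex set \<Rightarrow> complex set" where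
  "normal_closure_rat K = \<Inter>{L. complex_subfield L \<and> normal_over_rat L \<and> K \<subseteq> L}"

definition field_embedding_on :: "complex set \<Rightarrow> (complex \<Rightarrow> complex) \<Rightarrow> bool" where
  "field_embedding_on K \<sigma> \<longleftrightarrow> \<sigma> 1 = 1 \<and>
     (\<forall>x\<in>K. \<forall>y\<in>K. \<sigma> (x + y) = \<sigma> x + \<sigma> y \<and> \<sigma> (x * y) = \<sigma> x * \<sigma> y)"

text \<open>Field automorphisms of \<open>K\<close>; these automatically fix the rationals. Automorphisms are
  represented by total functions whose values outside \<open>K\<close> are irrelevant.\<close>

definition Gal_rat :: "complex set \<Rightarrow> (complex \<Rightarrow> complex) set" where
  "Gal_rat K = {\<sigma>. field_embedding_on K \<sigma> \<and> bij_betw \<sigma> K K}"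

definition totally_real_field :: "complex set \<Rightarrow> bool" where
  "totally_real_field K \<longleftrightarrow> number_field K \<and>
     (\<forall>\<sigma>. field_embedding_on K \<sigma> \<longrightarrow> \<sigma> ` K \<subseteq> \<real>)"

definition totally_imaginary_field :: "complex set \<Rightarrow> bool" where
  "totally_imaginary_field K \<longleftrightarrow> number_field K \<and>
     (\<forall>\<sigma>. field_embedding_on K \<sigma> \<longrightarrow> \<not> \<sigma> ` K \<subseteq> \<real>)"

text \<open>\<open>K\<close> is two-dimensional as a vector space over its subfield \<open>K0\<close>.\<close>

definition quadratic_extension :: "complex set \<Rightarrow> complex set \<Rightarrow> bool" where
  "quadratic_extension K0 K \<longleftrightarrow> complex_subfield K0 \<and> complex_subfield K \<and> K0 \<subseteq> K \<and>
     (\<exists>v\<in>K. \<exists>w\<in>K.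
        (\<forall>x\<in>K0. \<forall>y\<in>K0. x * v + y * w = 0 \<longrightarrow> x = 0 \<and> y = 0) \<and>
        (\<forall>z\<in>K. \<exists>x\<in>K0. \<exists>y\<in>K0. z = x * v + y * w))"

definition CM_field :: "complex set \<Rightarrow> bool" where
  "CM_field K \<longleftrightarrow> totally_imaginary_field K \<and>
     (\<exists>K0. totally_real_field K0 \<and> quadratic_extension K0 K)"


section \<open>Matrices with explicit finite index sets\<close>

definition inverse_matrices_on ::
  "'i set \<Rightarrow> 'j set \<Rightarrow> ('i \<Rightarrow> 'j \<Rightarrow> complex) \<Rightarrow> ('j \<Rightarrow> 'i \<Rightarrow> complex) \<Rightarrow> bool" where
  "inverse_matrices_on I J A B \<longleftrightarrow>
     (\<forall>i\<in>I. \<forall>i'\<in>I. (\<Sum>j\<in>J. A i j * B j i') = of_bool (i = i')) \<and>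
     (\<forall>j\<in>J. \<forall>j'\<in>J. (\<Sum>i\<in>I. B j i * A i j') = of_bool (j = j'))"

definition unitary_matrix_on ::
  "'i set \<Rightarrow> 'j set \<Rightarrow> ('i \<Rightarrow> 'j \<Rightarrow> complex) \<Rightarrow> bool" where
  "unitary_matrix_on I J A \<longleftrightarrow> inverse_matrices_on I J A (\<lambda>j i. cnj (A i j))"


section \<open>Modular tensor categories in terms of \<open>F\<close>, \<open>R\<close> and pivotal coefficients\<close>

text \<open>
  The anyons (isomorphism classes of simple objects) are the elements of a finite type.
  \<open>fus C a b c\<close> is the fusion coefficient \<open>N\<^sub>a\<^sub>b\<^sup>c\<close>; basis vectors of the fusion space
  \<open>V\<^sub>a\<^sub>b\<^sup>c = Hom(c, a \<otimes> b)\<close> are labelled by the numbers below it. A record carries the data of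
  a category together with a choice of these bases, i.e. a gauge. With \<open>|ab;c,\<alpha>\<rangle>\<close> for basis
  vectors, the conventions are

    \<^item> \<open>|ab;e,\<alpha>\<rangle>|ec;d,\<beta>\<rangle> = \<Sum> Fsym C a b c d (e,\<alpha>,\<beta>) (f,\<mu>,\<nu>) |bc;f,\<mu>\<rangle>|af;d,\<nu>\<rangle>\<close> for the
      associator \<open>(a \<otimes> b) \<otimes> c \<rightarrow> a \<otimes> (b \<otimes> c)\<close>, the sum being over \<open>(f,\<mu>,\<nu>)\<close>;
    \<^item> \<open>|ab;c,\<mu>\<rangle> = \<Sum> Rsym C a b c \<mu> \<nu> |ba;c,\<nu>\<rangle>\<close> for the braiding \<open>a \<otimes> b \<rightarrow> b \<otimes> a\<close>, the sum being
      over \<open>\<nu>\<close>.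

  Entries outside the index ranges below are junk and never constrained.
\<close>

record 'a mtc_data =
  vac :: 'a
  dual :: "'a \<Rightarrow> 'a"
  fus :: "'a \<Rightarrow> 'a \<Rightarrow> 'a \<Rightarrow> nat"
  Fsym :: "'a \<Rightarrow> 'a \<Rightarrow> 'a \<Rightarrow> 'a \<Rightarrow> 'a \<times> nat \<times> nat \<Rightarrow> 'a \<times> nat \<times> nat \<Rightarrow> complex"
  Rsym :: "'a \<Rightarrow> 'a \<Rightarrow> 'a \<Rightarrow> nat \<Rightarrow> nat \<Rightarrow> complex"
  piv :: "'a \<Rightarrow> complex"

definition fusion_rules :: "('a::finite) mtc_data \<Rightarrow> bool" where
  "fusion_rules C \<longleftrightarrow>
     (\<forall>a b. fus C (vac C) a b = of_bool (a = b)) \<and>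
     (\<forall>a b. fus C a (vac C) b = of_bool (a = b)) \<and>
     (\<forall>a b. fus C a b (vac C) = of_bool (b = dual C a)) \<and>
     (\<forall>a. dual C (dual C a) = a) \<and>
     (\<forall>a b c. fus C a b c = fus C b a c) \<and>
     (\<forall>a b c d. (\<Sum>e\<in>UNIV. fus C a b e * fus C e c d) = (\<Sum>f\<in>UNIV. fus C b c f * fus C a f d))"

definition F_rows :: "'a mtc_data \<Rightarrow> 'a \<Rightarrow> 'a \<Rightarrow> 'a \<Rightarrow> 'a \<Rightarrow> ('a \<times> nat \<times> nat) set" where
  "F_rows C a b c d = {(e, \<alpha>, \<beta>). \<alpha> < fus C a b e \<and> \<beta> < fus C e c d}"

definition F_cols :: "'a mtc_data \<Rightarrow> 'a \<Rightarrow> 'a \<Rightarrow> 'a \<Rightarrow> 'a \<Rightarrow> ('a \<times> nat \<times> nat) set" where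
  "F_cols C a b c d = {(f, \<mu>, \<nu>). \<mu> < fus C b c f \<and> \<nu> < fus C a f d}"

definition F_invertible :: "('a::finite) mtc_data \<Rightarrow> bool" where
  "F_invertible C \<longleftrightarrow>
     (\<forall>a b c d. \<exists>G. inverse_matrices_on (F_rows C a b c d) (F_cols C a b c d) (Fsym C a b c d) G)"

text \<open>Both sides express a vector of \<open>((ab)c)d\<close> with intermediate charges
  \<open>ab \<rightarrow> f\<close>, \<open>fc \<rightarrow> g\<close>, \<open>gd \<rightarrow> e\<close> through vectors of \<open>a(b(cd))\<close> with
  \<open>cd \<rightarrow> l\<close>, \<open>bl \<rightarrow> k\<close>, \<open>ak \<rightarrow> e\<close>.\<close>

definition pentagon :: "('a::finite) mtc_data \<Rightarrow> bool" where
  "pentagon C \<longleftrightarrow>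
     (\<forall>a b c d e f g k l \<alpha> \<beta> \<gamma> \<delta> \<kappa> \<mu>.
        \<alpha> < fus C a b f \<longrightarrow> \<beta> < fus C f c g \<longrightarrow> \<gamma> < fus C g d e \<longrightarrow>
        \<delta> < fus C c d l \<longrightarrow> \<kappa> < fus C b l k \<longrightarrow> \<mu> < fus C a k e \<longrightarrow>
        (\<Sum>\<sigma><fus C f l e.
            Fsym C f c d e (g, \<beta>, \<gamma>) (l, \<delta>, \<sigma>) * Fsym C a b l e (f, \<alpha>, \<sigma>) (k, \<kappa>, \<mu>)) =
        (\<Sum>h\<in>UNIV. \<Sum>\<eta><fus C b c h. \<Sum>\<psi><fus C a h g. \<Sum>\<rho><fus C h d k.
            Fsym C a b c g (f, \<alpha>, \<beta>) (h, \<eta>, \<psi>) * Fsym C a h d e (g, \<psi>, \<gamma>) (k, \<rho>, \<mu>) *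
            Fsym C b c d k (h, \<eta>, \<rho>) (l, \<delta>, \<kappa>)))"

text \<open>The triangle axioms, in bases in which the unitors are trivial.\<close>

definition triangle :: "('a::finite) mtc_data \<Rightarrow> bool" where
  "triangle C \<longleftrightarrow>
     (\<forall>b c d. \<forall>\<beta><fus C b c d. \<forall>\<mu><fus C b c d.
        Fsym C (vac C) b c d (b, 0, \<beta>) (d, \<mu>, 0) = of_bool (\<beta> = \<mu>) \<and>
        Fsym C b (vac C) c d (b, 0, \<beta>) (c, 0, \<mu>) = of_bool (\<beta> = \<mu>) \<and>
        Fsym C b c (vac C) d (d, \<beta>, 0) (c, 0, \<mu>) = of_bool (\<beta> = \<mu>))"

text \<open>The displayed entry is the composite \<open>a \<rightarrow> (a a*) a \<rightarrow> a (a* a) \<rightarrow> a\<close>. If it is nonzero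
  then, after rescaling, \<open>a*\<close> is a dual of \<open>a\<close>.\<close>

definition rigid :: "('a::finite) mtc_data \<Rightarrow> bool" where
  "rigid C \<longleftrightarrow> (\<forall>a. Fsym C a (dual C a) a a (vac C, 0, 0) (vac C, 0, 0) \<noteq> 0)"

text \<open>The hexagon for a family of braiding matrices: both sides express a vector of \<open>(ab)c\<close>
  through vectors of \<open>b(ca)\<close>.\<close>

definition hexagon ::
  "('a::finite) mtc_data \<Rightarrow> ('a \<Rightarrow> 'a \<Rightarrow> 'a \<Rightarrow> nat \<Rightarrow> nat \<Rightarrow> complex) \<Rightarrow> bool" where
  "hexagon C R \<longleftrightarrow>
     (\<forall>a b c d e g \<alpha> \<beta> \<sigma> \<tau>.
        \<alpha> < fus C a b e \<longrightarrow> \<beta> < fus C e c d \<longrightarrow> \<sigma> < fus C c a g \<longrightarrow> \<tau> < fus C b g d \<longrightarrow>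
        (\<Sum>f\<in>UNIV. \<Sum>\<mu><fus C b c f. \<Sum>\<nu><fus C a f d. \<Sum>\<rho><fus C f a d.
            Fsym C a b c d (e, \<alpha>, \<beta>) (f, \<mu>, \<nu>) * R a f d \<nu> \<rho> *
            Fsym C b c a d (f, \<mu>, \<rho>) (g, \<sigma>, \<tau>)) =
        (\<Sum>\<alpha>'<fus C b a e. \<Sum>\<sigma>'<fus C a c g.
            R a b e \<alpha> \<alpha>' * Fsym C b a c d (e, \<alpha>', \<beta>) (g, \<sigma>', \<tau>) * R a c g \<sigma>' \<sigma>))"

text \<open>The second hexagon is the first one for the inverse braiding.\<close>

definition braided :: "('a::finite) mtc_data \<Rightarrow> bool" where
  "braided C \<longleftrightarrow> hexagon C (Rsym C) \<and>
     (\<exists>R'. (\<forall>a b c. inverse_matrices_on {..<fus C a b c} {..<fus C b a c}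
                       (Rsym C a b c) (R' b a c)) \<and>
           hexagon C R')"

text \<open>Rotating \<open>a\<close> from the left to the right of a vector of \<open>Hom(1, a a*)\<close> by means of the
  pivotal structure multiplies it by the inverse of \<open>piv C a\<close>. Monoidality of the pivotal structure
  says that rotating successively \<open>a\<close>, \<open>b\<close> and \<open>c\<close> acts trivially on \<open>Hom(1, (ab)c)\<close>.\<close>

definition pivotal :: "('a::finite) mtc_data \<Rightarrow> bool" where
  "pivotal C \<longleftrightarrow> (\<forall>a. piv C a \<in> {1, -1}) \<and>
     (\<forall>a b c. \<forall>\<alpha><fus C a b (dual C c). \<forall>\<alpha>'<fus C a b (dual C c).
        (\<Sum>\<mu><fus C b c (dual C a). \<Sum>\<nu><fus C c a (dual C b).
            Fsym C a b c (vac C) (dual C c, \<alpha>, 0) (dual C a, \<mu>, 0) *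
            Fsym C b c a (vac C) (dual C a, \<mu>, 0) (dual C b, \<nu>, 0) *
            Fsym C c a b (vac C) (dual C b, \<nu>, 0) (dual C c, \<alpha>', 0)) =
        piv C a * piv C b * piv C c * of_bool (\<alpha> = \<alpha>'))"

text \<open>The evaluation \<open>a* a \<rightarrow> 1\<close> is the covector dual to the basis vector of \<open>Hom(1, a* a)\<close>
  divided by the \<open>F\<close> entry below, as the zigzag identity demands; closing the loop with the
  pivotal structure gives the quantum dimension (using that \<open>piv C a\<close> is its own inverse).\<close>

definition qdim :: "'a mtc_data \<Rightarrow> 'a \<Rightarrow> complex" where
  "qdim C a = piv C a / Fsym C a (dual C a) a a (vac C, 0, 0) (vac C, 0, 0)"

text \<open>Equality of left and right quantum dimensions. It is not implied by the coefficients
  \<open>piv C a\<close> being signs, since for \<open>a \<noteq> a*\<close> these depend on the gauge.\<close>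

definition spherical :: "('a::finite) mtc_data \<Rightarrow> bool" where
  "spherical C \<longleftrightarrow> (\<forall>a. qdim C (dual C a) = qdim C a)"

text \<open>The unnormalised \<open>S\<close> matrix: the trace of the double braiding of \<open>a\<close> and \<open>b\<close>.\<close>

definition S_matrix :: "('a::finite) mtc_data \<Rightarrow> complex ^ 'a ^ 'a" where
  "S_matrix C = (\<chi> a b. \<Sum>c\<in>UNIV. qdim C c *
      (\<Sum>\<mu><fus C a b c. \<Sum>\<nu><fus C b a c. Rsym C a b c \<mu> \<nu> * Rsym C b a c \<nu> \<mu>))"

definition modular_tensor_category :: "('a::finite) mtc_data \<Rightarrow> bool" where
  "modular_tensor_category C \<longleftrightarrow>
     fusion_rules C \<and> F_invertible C \<and> pentagon C \<and> triangle C \<and> rigid C \<and>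
     braided C \<and> pivotal C \<and> spherical C \<and> invertible (S_matrix C)"


section \<open>Gauge transformations\<close>

text \<open>\<open>C'\<close> is the description of \<open>C\<close> in the bases
  \<open>|ab;c,\<alpha>\<rangle>' = \<Sum> U a b c \<alpha> \<alpha>' |ab;c,\<alpha>'\<rangle>\<close>. The pivotal coefficients are those of the
  same pivotal structure; since the identification of \<open>a\<close> with its double dual depends on the bases of
  \<open>Hom(1, a a*)\<close> and \<open>Hom(1, a* a)\<close>, so do they. The quantum dimensions
  are gauge invariant as long as the pivotal coefficients remain signs.\<close>

definition gauge_transformed ::
  "('a \<Rightarrow> 'a \<Rightarrow> 'a \<Rightarrow> nat \<Rightarrow> nat \<Rightarrow> complex) \<Rightarrow> ('a::finite) mtc_data \<Rightarrow> 'a mtc_data \<Rightarrow> bool" where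
  "gauge_transformed U C C' \<longleftrightarrow>
     vac C' = vac C \<and> dual C' = dual C \<and> fus C' = fus C \<and>
     (\<forall>a b c. \<exists>V. inverse_matrices_on {..<fus C a b c} {..<fus C a b c} (U a b c) V) \<and>
     (\<forall>a b c d e f \<alpha> \<beta> \<mu> \<nu>. (e, \<alpha>, \<beta>) \<in> F_rows C a b c d \<longrightarrow> (f, \<mu>, \<nu>) \<in> F_cols C a b c d \<longrightarrow>
        (\<Sum>\<mu>'<fus C b c f. \<Sum>\<nu>'<fus C a f d.
            Fsym C' a b c d (e, \<alpha>, \<beta>) (f, \<mu>', \<nu>') * U b c f \<mu>' \<mu> * U a f d \<nu>' \<nu>) =
        (\<Sum>\<alpha>'<fus C a b e. \<Sum>\<beta>'<fus C e c d.
            U a b e \<alpha> \<alpha>' * U e c d \<beta> \<beta>' * Fsym C a b c d (e, \<alpha>', \<beta>') (f, \<mu>, \<nu>))) \<and>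
     (\<forall>a b c. \<forall>\<mu><fus C a b c. \<forall>\<nu><fus C b a c.
        (\<Sum>\<nu>'<fus C b a c. Rsym C' a b c \<mu> \<nu>' * U b a c \<nu>' \<nu>) =
        (\<Sum>\<mu>'<fus C a b c. U a b c \<mu> \<mu>' * Rsym C a b c \<mu>' \<nu>)) \<and>
     (\<forall>a. piv C' a * U a (dual C a) (vac C) 0 0 = piv C a * U (dual C a) a (vac C) 0 0)"

text \<open>Requiring \<open>C'\<close> to satisfy the axioms restricts to gauges with trivial unitors and pivotal
  coefficients \<open>\<plusminus>1\<close>.\<close>

definition is_gauge_of :: "('a::finite) mtc_data \<Rightarrow> 'a mtc_data \<Rightarrow> bool" where
  "is_gauge_of C' C \<longleftrightarrow> modular_tensor_category C' \<and> (\<exists>U. gauge_transformed U C C')"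

definition F_unitary :: "('a::finite) mtc_data \<Rightarrow> bool" where
  "F_unitary C \<longleftrightarrow>
     (\<forall>a b c d. unitary_matrix_on (F_rows C a b c d) (F_cols C a b c d) (Fsym C a b c d))"

definition R_unitary :: "('a::finite) mtc_data \<Rightarrow> bool" where
  "R_unitary C \<longleftrightarrow>
     (\<forall>a b c. unitary_matrix_on {..<fus C a b c} {..<fus C b a c} (Rsym C a b c))"

definition unitary_mtc :: "('a::finite) mtc_data \<Rightarrow> bool" where
  "unitary_mtc C \<longleftrightarrow> modular_tensor_category C \<and>
     (\<exists>C'. is_gauge_of C' C \<and> F_unitary C' \<and> R_unitary C' \<and>
        (\<forall>a. qdim C' a \<in> \<real> \<and> 0 < Re (qdim C' a)))"

text \<open>A TQFT is a modular tensor category with a choice \<open>D\<close> of square root of the sum of the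
  squared quantum dimensions.\<close>

definition tqft :: "('a::finite) mtc_data \<Rightarrow> complex \<Rightarrow> bool" where
  "tqft C D \<longleftrightarrow> modular_tensor_category C \<and> D\<^sup>2 = (\<Sum>a\<in>UNIV. (qdim C a)\<^sup>2)"

definition unitary_tqft :: "('a::finite) mtc_data \<Rightarrow> complex \<Rightarrow> bool" where
  "unitary_tqft C D \<longleftrightarrow> tqft C D \<and> unitary_mtc C \<and> D \<in> \<real> \<and> 0 < Re D"


section \<open>Defining number field and Galois conjugation\<close>

definition F_entries :: "'a mtc_data \<Rightarrow> complex set" where
  "F_entries C = {Fsym C a b c d i j | a b c d i j. i \<in> F_rows C a b c d \<and> j \<in> F_cols C a b c d}"

definition R_entries :: "'a mtc_data \<Rightarrow> complex set" where
  "R_entries C = {Rsym C a b c \<mu> \<nu> | a b c \<mu> \<nu>. \<mu> < fus C a b c \<and> \<nu> < fus C b a c}"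

definition number_field_gauge :: "'a mtc_data \<Rightarrow> bool" where
  "number_field_gauge C \<longleftrightarrow> number_field (field_generated (F_entries C \<union> R_entries C))"

definition defining_number_field :: "'a mtc_data \<Rightarrow> complex set" where
  "defining_number_field C = normal_closure_rat (field_generated (F_entries C \<union> R_entries C))"

definition F_number_field :: "'a mtc_data \<Rightarrow> complex set" where
  "F_number_field C = normal_closure_rat (field_generated (F_entries C))"

definition galois_conjugate :: "(complex \<Rightarrow> complex) \<Rightarrow> 'a mtc_data \<Rightarrow> 'a mtc_data" where
  "galois_conjugate q C =
     C\<lparr>Fsym := (\<lambda>a b c d i j. q (Fsym C a b c d i j)),
       Rsym := (\<lambda>a b c \<mu> \<nu>. q (Rsym C a b c \<mu> \<nu>))\<rparr>"

end

(*
  The conjugate of a unitary F by an automorphism sigma is unitary as soon as sigma commutes with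
  complex conjugation on the entries of F, which is what the totally real or CM hypothesis gives.
  Since the unitary gauge C' need not be defined over K_C, q is first extended to a field that
  contains the entries of C', of the gauge transformation and of all inverse matrices; then
  sigma(C') is a gauge of q(C) with unitary F and positive quantum dimensions.

  It remains to see that such a gauge automatically has unitary R (a theorem of Galindo). For
  simple a, the partial trace over b of R*R on (a b) is a scalar; by the hexagon it is a positive
  character of the fusion ring in b, hence equal to d_b. The same holds for the inverse braiding, so
  T = R*R satisfies Tr(T) = Tr(T^-1) = Tr(1) for the faithful categorical trace, which forces T = 1.
*)

theory Submission
  imports Defs
begin

section \<open>Extending embeddings of subfields of the complex numbers\<close>

text \<open>Compatibility with complex conjugation is available only on the field of the
  \<open>F\<close> symbols. The braiding entries may lie where an embedding and \<open>cnj\<close>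
  do not commute, so unitarity of the conjugated \<open>Rsym\<close> cannot be obtained by
  conjugating equations; this is why it is recovered from \<open>F\<close> and positive dimensions.
  The data carry no adjoint, so the categorical trace is made concrete as a sum over fusion channels
  \<open>e\<close> with weights \<open>d e\<close>. That such sums are compatible with recoupling
  amounts to the bending matrices \<open>B\<close> being multiples of unitaries, which the pentagon,
  the pivotal axiom and the positivity of \<open>d\<close> yield together. That \<open>q\<close>
  fixes the quantum dimensions keeps \<open>d\<close> positive after conjugation. A gauge
  transformation may have transcendental entries, so extending embeddings to algebraic elements does
  not suffice. But only finitely many numbers matter: they can be adjoined one at a time to a
  countable field, and countability leaves room in the complex numbers for the image of a
  transcendental element.\<close>

lemma complex_subfieldD:
  assumes "complex_subfield K"
  shows "0 \<in> K" "1 \<in> K" "x \<in> K \<Longrightarrow> y \<in> K \<Longrightarrow> x + y \<in> K" "x \<in> K \<Longrightarrow> y \<in> K \<Longrightarrow> x * y \<in> K"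
    "x \<in> K \<Longrightarrow> - x \<in> K" "x \<in> K \<Longrightarrow> inverse x \<in> K" "x \<in> K \<Longrightarrow> y \<in> K \<Longrightarrow> x - y \<in> K"
    "x \<in> K \<Longrightarrow> y \<in> K \<Longrightarrow> x / y \<in> K"
  using assms unfolding complex_subfield_def
       apply blast+
   apply (metis assms complex_subfield_def diff_conv_add_uminus)
  by (metis assms complex_subfield_def divide_inverse)

lemma complex_subfield_sum:
  assumes "complex_subfield K" "\<And>i. i \<in> I \<Longrightarrow> f i \<in> K"
  shows "(\<Sum>i\<in>I. f i) \<in> K"
  using assms(2) by (induction I rule: infinite_finite_induct) (auto intro: complex_subfieldD[OF assms(1)])

lemma complex_subfield_of_nat: "complex_subfield K \<Longrightarrow> of_nat n \<in> K"
  by (induction n) (auto intro: complex_subfieldD)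

lemma complex_subfield_of_int: "complex_subfield K \<Longrightarrow> of_int n \<in> K"
  by (cases n) (auto intro!: complex_subfieldD complex_subfield_of_nat simp del: of_nat_Suc)

lemma complex_subfield_of_rat:
  assumes "complex_subfield K"
  shows "of_rat r \<in> K"
  by (cases r) (auto simp: of_rat_rat intro!: complex_subfieldD[OF assms] complex_subfield_of_int[OF assms])

lemma complex_subfield_field_generated: "complex_subfield (field_generated S)"
  unfolding field_generated_def complex_subfield_def by blast

lemma field_generated_superset: "S \<subseteq> field_generated S"
  unfolding field_generated_def by blast

lemma normal_closure_rat_superset: "K \<subseteq> normal_closure_rat K"
  unfolding normal_closure_rat_def by blast

lemma number_field_countable:
  assumes "number_field K"
  shows "countable K"
proof -
  obtain B where B: "finite B" "\<forall>x\<in>K. \<exists>r :: complex \<Rightarrow> rat. x = (\<Sum>b\<in>B. of_rat (r b) * b)"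
    using assms unfolding number_field_def by blast
  have "K \<subseteq> (\<lambda>r. \<Sum>b\<in>B. of_rat (r b) * b) ` (B \<rightarrow>\<^sub>E (UNIV :: rat set))"
  proof
    fix x assume "x \<in> K"
    then obtain r :: "complex \<Rightarrow> rat" where "x = (\<Sum>b\<in>B. of_rat (r b) * b)"
      using B by blast
    then have "x = (\<Sum>b\<in>B. of_rat (restrict r B b) * b)" by simp
    then show "x \<in> (\<lambda>r. \<Sum>b\<in>B. of_rat (r b) * b) ` (B \<rightarrow>\<^sub>E (UNIV :: rat set))"
      by (intro image_eqI[where x = "restrict r B"]) auto
  qed
  moreover have "countable (B \<rightarrow>\<^sub>E (UNIV :: rat set))"
    using B(1) by (intro countable_PiE) auto
  ultimately show ?thesis
    by (rule countable_subset[OF _ countable_image])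
qed

lemma field_embedding_on_subset:
  "field_embedding_on K \<sigma> \<Longrightarrow> L \<subseteq> K \<Longrightarrow> field_embedding_on L \<sigma>"
  unfolding field_embedding_on_def by blast

locale subfield_embedding =
  fixes L :: "complex set" and \<sigma> :: "complex \<Rightarrow> complex"
  assumes subfield: "complex_subfield L" and embedding: "field_embedding_on L \<sigma>"
begin

lemmas closed [simp] = complex_subfieldD[OF subfield]
lemmas closed_sum = complex_subfield_sum[OF subfield]

lemma add: "x \<in> L \<Longrightarrow> y \<in> L \<Longrightarrow> \<sigma> (x + y) = \<sigma> x + \<sigma> y"
  and mult: "x \<in> L \<Longrightarrow> y \<in> L \<Longrightarrow> \<sigma> (x * y) = \<sigma> x * \<sigma> y"
  and one [simp]: "\<sigma> 1 = 1"
  using embedding unfolding field_embedding_on_def by auto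

lemma zero [simp]: "\<sigma> 0 = 0"
  using add[of 0 0] by simp

lemma uminus: "x \<in> L \<Longrightarrow> \<sigma> (- x) = - \<sigma> x"
  using add[of x "- x"] by (simp add: eq_neg_iff_add_eq_0 add.commute)

lemma diff: "x \<in> L \<Longrightarrow> y \<in> L \<Longrightarrow> \<sigma> (x - y) = \<sigma> x - \<sigma> y"
  using add[of x "- y"] uminus[of y] by simp

lemma eq_0_iff: "x \<in> L \<Longrightarrow> \<sigma> x = 0 \<longleftrightarrow> x = 0"
  using mult[of x "inverse x"] by (cases "x = 0") auto

lemma inverse: "x \<in> L \<Longrightarrow> \<sigma> (inverse x) = inverse (\<sigma> x)"
  using mult[of x "inverse x"] eq_0_iff[of x] by (cases "x = 0") (auto simp: field_simps)

lemma divide: "x \<in> L \<Longrightarrow> y \<in> L \<Longrightarrow> \<sigma> (x / y) = \<sigma> x / \<sigma> y"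
  using mult[of x "inverse y"] inverse[of y] by (simp add: divide_inverse)

lemma sum: "(\<And>i. i \<in> I \<Longrightarrow> f i \<in> L) \<Longrightarrow> \<sigma> (\<Sum>i\<in>I. f i) = (\<Sum>i\<in>I. \<sigma> (f i))"
  by (induction I rule: infinite_finite_induct) (auto simp: add closed_sum)

lemma of_bool [simp]: "\<sigma> (of_bool P) = of_bool P"
  by (cases P) auto

section \<open>Polynomials over \<open>L\<close> and simple extensions of \<open>L\<close>\<close>

definition polys :: "complex poly set" where
  "polys = {p. \<forall>i. coeff p i \<in> L}"

lemma polysD: "p \<in> polys \<Longrightarrow> coeff p i \<in> L"
  unfolding polys_def by auto

lemma polys_add [simp]: "p \<in> polys \<Longrightarrow> r \<in> polys \<Longrightarrow> p + r \<in> polys"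
  and polys_diff [simp]: "p \<in> polys \<Longrightarrow> r \<in> polys \<Longrightarrow> p - r \<in> polys"
  and polys_mult [simp]: "p \<in> polys \<Longrightarrow> r \<in> polys \<Longrightarrow> p * r \<in> polys"
  and polys_const [simp]: "c \<in> L \<Longrightarrow> [:c:] \<in> polys"
  and polys_monom [simp]: "c \<in> L \<Longrightarrow> monom c n \<in> polys"
  by (auto simp: polys_def coeff_mult coeff_pCons split: nat.splits intro!: closed_sum)

abbreviation hom :: "complex poly \<Rightarrow> complex poly" where
  "hom \<equiv> map_poly \<sigma>"

lemma coeff_hom [simp]: "coeff (hom p) i = \<sigma> (coeff p i)"
  by (simp add: coeff_map_poly)

lemma hom_add: "p \<in> polys \<Longrightarrow> r \<in> polys \<Longrightarrow> hom (p + r) = hom p + hom r"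
  and hom_diff: "p \<in> polys \<Longrightarrow> r \<in> polys \<Longrightarrow> hom (p - r) = hom p - hom r"
  and hom_mult: "p \<in> polys \<Longrightarrow> r \<in> polys \<Longrightarrow> hom (p * r) = hom p * hom r"
  by (auto simp: poly_eq_iff polysD add diff mult coeff_mult sum)

lemma hom_const [simp]: "hom [:c:] = [:\<sigma> c:]"
  by (auto simp: poly_eq_iff coeff_pCons split: nat.splits)

lemma degree_hom: "p \<in> polys \<Longrightarrow> degree (hom p) = degree p"
  by (cases "p = 0") (auto intro!: map_poly_degree_eq simp: polysD eq_0_iff)

lemma hom_eq_0_iff: "p \<in> polys \<Longrightarrow> hom p = 0 \<longleftrightarrow> p = 0"
  by (auto simp: poly_eq_iff polysD eq_0_iff)

lemma polys_division:
  assumes "p \<in> polys" "p \<noteq> 0" "f \<in> polys"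
  shows "\<exists>s\<in>polys. \<exists>r\<in>polys. f = p * s + r \<and> (r = 0 \<or> degree r < degree p)"
  using assms(3)
\<comment> \<open>The measure puts the zero polynomial strictly below the nonzero constants, which
  \<open>degree\<close> alone does not separate; this matters when \<open>p\<close> is
  constant.\<close>
proof (induction "if f = 0 then 0 else Suc (degree f)" arbitrary: f rule: less_induct)
  case less
  show ?case
  proof (cases "f = 0 \<or> degree f < degree p")
    case True
    then show ?thesis using less.prems by (intro bexI[of _ 0] bexI[of _ f]) (auto simp: polys_def)
  next
    case False
    define m where "m = monom (lead_coeff f / lead_coeff p) (degree f - degree p)"
    have m: "m \<in> polys" unfolding m_def using less.prems assms(1) by (auto simp: polysD)
    have "f - p * m = 0 \<or> degree (f - p * m) < degree f"
    proof (rule disjCI)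
      have "lead_coeff f / lead_coeff p \<noteq> 0" using False assms(2) by simp
      then have "degree m = degree f - degree p" "m \<noteq> 0"
        unfolding m_def by (auto simp: degree_monom_eq monom_eq_0_iff)
      then have dm: "degree (p * m) = degree f"
        using False assms(2) by (simp add: degree_mult_eq)
      have lc: "lead_coeff (p * m) = lead_coeff f"
        using assms(2) lead_coeff_monom[of "lead_coeff f / lead_coeff p" "degree f - degree p"]
        unfolding lead_coeff_mult m_def by (simp only:) simp
      assume "\<not> degree (f - p * m) < degree f"
      moreover have "degree (f - p * m) \<le> degree f"
        using dm degree_diff_le by (metis order_refl)
      ultimately have "degree (f - p * m) = degree f" by simp
      then have "lead_coeff (f - p * m) = 0" using lc dm by simp
      then show "f - p * m = 0" by (simp only: leading_coeff_0_iff)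
    qed
    then have "(if f - p * m = 0 then 0 else Suc (degree (f - p * m))) < (if f = 0 then 0 else Suc (degree f))"
      using False by auto
    moreover have "f - p * m \<in> polys" using less.prems assms(1) m by simp
    ultimately obtain s r where sr: "s \<in> polys" "r \<in> polys" "f - p * m = p * s + r" "r = 0 \<or> degree r < degree p"
      using less.hyps[of "f - p * m"] by blast
    have "f = p * (m + s) + r" using sr(3) by (simp add: algebra_simps)
    then show ?thesis using sr m polys_add by blast
  qed
qed

lemma countable_polys: "countable L \<Longrightarrow> countable polys"
proof -
  assume "countable L"
  then have *: "countable (Poly ` lists L)" by (intro countable_image countable_lists)
  have "polys \<subseteq> Poly ` lists L"
  proof
    fix p assume p: "p \<in> polys"
    have "set (coeffs p) \<subseteq> L" using p by (auto simp: coeffs_def polysD)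
    then show "p \<in> Poly ` lists L" by (intro image_eqI[of _ _ "coeffs p"]) auto
  qed
  then show ?thesis using * by (rule countable_subset)
qed

text \<open>Countability supplies an element transcendental over \<open>\<sigma> ` L\<close> when \<open>x\<close> is transcendental over
  \<open>L\<close>; for algebraic \<open>x\<close> a root of the conjugated minimal polynomial does.\<close>

lemma exists_conjugate:
  assumes "countable L"
  shows "\<exists>y. \<forall>f\<in>polys. poly f x = 0 \<longleftrightarrow> poly (hom f) y = 0"
proof (cases "\<exists>f\<in>polys. f \<noteq> 0 \<and> poly f x = 0")
  case False
  let ?bad = "\<Union>f\<in>polys - {0}. {y. poly (hom f) y = 0}"
  have "countable ?bad"
    using countable_polys[OF assms]
    by (intro countable_UN countable_Diff) (auto intro!: countable_finite poly_roots_finite simp: hom_eq_0_iff)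
  moreover have "uncountable (UNIV :: complex set)"
  proof
    assume "countable (UNIV :: complex set)"
    then have "countable (range Re)" by (rule countable_image)
    moreover have "range Re = UNIV" by (metis Re_complex_of_real surjI)
    ultimately show False using uncountable_UNIV_real by simp
  qed
  ultimately obtain y where "y \<notin> ?bad" by (metis UNIV_eq_I)
  then have "\<forall>f\<in>polys. poly (hom f) y = 0 \<longrightarrow> f = 0" by blast
  then show ?thesis using False by (intro exI[of _ y]) auto
next
  case True
  define Q where "Q = (\<lambda>f. f \<in> polys \<and> f \<noteq> 0 \<and> poly f x = 0)"
  define p where "p = arg_min degree Q"
  have ex: "Q p" and min: "\<And>f. Q f \<Longrightarrow> degree p \<le> degree f"
    using True arg_min_natI[of Q _ degree] arg_min_nat_le[of Q _ degree] unfolding p_def Q_def by blast+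
  have p: "p \<in> polys" "p \<noteq> 0" "poly p x = 0" using ex unfolding Q_def by auto
  have "degree p \<noteq> 0" using p by (metis degree_0_id poly_0 degree_eq_zeroE pCons_0_0 poly_const_conv)
  then have "\<not> constant (poly (hom p))"
    using p(1) by (simp add: constant_degree degree_hom)
  then obtain y where y: "poly (hom p) y = 0"
    using fundamental_theorem_of_algebra by blast
  have vanish: "f = 0" if "f \<in> polys" "poly f x = 0" "f = 0 \<or> degree f < degree p" for f
    using min[of f] that unfolding Q_def by (meson leD)
  have dir: "poly (hom f) y = 0" if f: "f \<in> polys" "poly f x = 0" for f
  proof -
    obtain s r where sr: "s \<in> polys" "r \<in> polys" "f = p * s + r" "r = 0 \<or> degree r < degree p"
      using polys_division[OF p(1,2) f(1)] by blast
    have "poly r x = 0" using f(2) sr(3) p(3) by simp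
    then have "r = 0" using vanish sr by blast
    then show ?thesis using sr p y by (simp add: hom_mult)
  qed
  \<comment> \<open>Irreducibility of the minimal polynomial in the form of a Euclidean descent. The
    remainder of \<open>p\<close> modulo \<open>f\<close> again vanishes at \<open>y\<close> after
    conjugation, hence at \<open>x\<close> by induction, hence is zero by minimality. So
    \<open>f\<close> divides \<open>p\<close>, and if \<open>f\<close> did not vanish at
    \<open>x\<close> the cofactor would, which leaves degree 0 for \<open>f\<close>.\<close>
  have small: "poly f x = 0" if "f \<in> polys" "poly (hom f) y = 0" "degree f < degree p" for f
    using that
  proof (induction "degree f" arbitrary: f rule: less_induct)
    case less
    show ?case
    proof (rule ccontr)
      assume nz: "poly f x \<noteq> 0"
      then have f0: "f \<noteq> 0" by auto
      obtain s r where sr: "s \<in> polys" "r \<in> polys" "p = f * s + r" "r = 0 \<or> degree r < degree f"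
        using polys_division[OF less.prems(1) f0 p(1)] by blast
      have "hom p = hom f * hom s + hom r" using sr less.prems by (metis hom_add hom_mult polys_mult)
      then have "poly (hom r) y = 0" using y less.prems by simp
      then have rx: "poly r x = 0" using less.hyps[of r] sr less.prems by auto
      then have r: "r = 0"
        using vanish[of r] sr less.prems by auto
      then have s: "s \<noteq> 0" "poly s x = 0" using sr p nz by auto
      have "degree p = degree f + degree s" using r sr(3) s(1) f0 by (simp add: degree_mult_eq)
      moreover have "degree p \<le> degree s" using min[of s] s sr unfolding Q_def by blast
      ultimately have "degree f = 0" by simp
      then obtain c where c: "f = [:c:]" by (metis degree_eq_zeroE)
      then have "\<sigma> c = 0" "c \<in> L" using less.prems polysD[of f 0] by auto
      then show False using nz c eq_0_iff by simp
    qed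
  qed
  have "poly f x = 0" if f: "f \<in> polys" "poly (hom f) y = 0" for f
  proof -
    obtain s r where sr: "s \<in> polys" "r \<in> polys" "f = p * s + r" "r = 0 \<or> degree r < degree p"
      using polys_division[OF p(1,2) f(1)] by blast
    have "hom f = hom p * hom s + hom r" using sr p by (metis hom_add hom_mult polys_mult)
    then have "poly (hom r) y = 0" using y f by simp
    then have "poly r x = 0" using small[of r] sr by auto
    then show ?thesis using sr p by simp
  qed
  then show ?thesis using dir by blast
qed

text \<open>The field generated by \<open>x\<close> consists of quotients of polynomials at
  \<open>x\<close>, whether \<open>x\<close> is algebraic or not, and \<open>x\<close> is sent to
  the \<open>y\<close> of \<open>exists_conjugate\<close>. One direction of that equivalence makes
  the value independent of the chosen quotient, the other keeps denominators nonzero. Countability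
  is preserved so that the step can be iterated.\<close>

lemma extend_to_element:
  assumes "countable L"
  shows "\<exists>L' \<sigma>'. countable L' \<and> subfield_embedding L' \<sigma>' \<and> L \<subseteq> L' \<and> x \<in> L' \<and> (\<forall>z\<in>L. \<sigma>' z = \<sigma> z)"
proof -
  obtain y where y: "\<And>f. f \<in> polys \<Longrightarrow> poly f x = 0 \<longleftrightarrow> poly (hom f) y = 0"
    using exists_conjugate[OF assms] by blast
  define rep where "rep = (\<lambda>z (f, g). f \<in> polys \<and> g \<in> polys \<and> poly g x \<noteq> 0 \<and> z = poly f x / poly g x)"
  define L' where "L' = {z. \<exists>fg. rep z fg}"
  define ev where "ev = (\<lambda>(f, g). poly (hom f) y / poly (hom g) y)"
  define \<sigma>' where "\<sigma>' = (\<lambda>z. ev (SOME fg. rep z fg))"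
  have \<sigma>': "\<sigma>' z = ev fg" if "rep z fg" for z fg
  proof -
    obtain f g where fg: "fg = (f, g)" by (cases fg)
    obtain f' g' where fg': "(SOME fg. rep z fg) = (f', g')" by (cases "SOME fg. rep z fg")
    have "rep z (f', g')" using someI[of "rep z", OF that] fg' by simp
    then have r: "f \<in> polys" "g \<in> polys" "f' \<in> polys" "g' \<in> polys" "poly g x \<noteq> 0" "poly g' x \<noteq> 0"
      "poly f x / poly g x = poly f' x / poly g' x" using that fg unfolding rep_def by auto
    then have "poly (f * g' - f' * g) x = 0" by (simp add: field_simps)
    then have "poly (hom (f * g' - f' * g)) y = 0"
      using r(1-4) y[of "f * g' - f' * g"] by (simp add: polys_diff polys_mult)
    moreover have "hom (f * g' - f' * g) = hom f * hom g' - hom f' * hom g"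
      using r by (simp add: hom_diff hom_mult polys_mult)
    moreover have "poly (hom g) y \<noteq> 0" "poly (hom g') y \<noteq> 0" using r y by auto
    ultimately show ?thesis unfolding \<sigma>'_def fg fg' ev_def by (simp add: field_simps)
  qed
  have L'D: "\<exists>f g. rep z (f, g)" if "z \<in> L'" for z
    using that unfolding L'_def mem_Collect_eq split_paired_Ex .
  have rep_const: "rep z ([:z:], 1)" if "z \<in> L" for z
    using that unfolding rep_def by (auto simp: one_pCons)
  have rep_add: "rep (z + w) (f * k + h * g, g * k)" and rep_mult: "rep (z * w) (f * h, g * k)"
    if "rep z (f, g)" "rep w (h, k)" for z w f g h k
    using that unfolding rep_def by (auto simp: add_frac_eq intro: polys_add polys_mult)
  have hom_nz: "poly (hom g) y \<noteq> 0" if "rep z (f, g)" for z f g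
    using that y unfolding rep_def by auto
  have hom_add': "\<sigma>' (z + w) = \<sigma>' z + \<sigma>' w" and hom_mult': "\<sigma>' (z * w) = \<sigma>' z * \<sigma>' w"
    if zw: "z \<in> L'" "w \<in> L'" for z w
  proof -
    obtain f g h k where r: "rep z (f, g)" "rep w (h, k)" using L'D zw by blast
    have p: "f \<in> polys" "g \<in> polys" "h \<in> polys" "k \<in> polys" using r unfolding rep_def by auto
    show "\<sigma>' (z + w) = \<sigma>' z + \<sigma>' w"
      unfolding \<sigma>'[OF r(1)] \<sigma>'[OF r(2)] \<sigma>'[OF rep_add[OF r]]
      using p hom_nz[OF r(1)] hom_nz[OF r(2)]
      by (simp add: ev_def hom_add hom_mult polys_mult field_simps)
    show "\<sigma>' (z * w) = \<sigma>' z * \<sigma>' w"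
      unfolding \<sigma>'[OF r(1)] \<sigma>'[OF r(2)] \<sigma>'[OF rep_mult[OF r]]
      using p by (simp add: ev_def hom_mult)
  qed
  have sub: "L \<subseteq> L'" using rep_const unfolding L'_def by blast
  have restr: "\<sigma>' z = \<sigma> z" if "z \<in> L" for z
    using \<sigma>'[OF rep_const[OF that]] by (simp add: ev_def one_pCons)
  have inv: "inverse z \<in> L'" if "z \<in> L'" for z
  proof (cases "z = 0")
    case False
    obtain f g where r: "rep z (f, g)" using \<open>z \<in> L'\<close> L'D by blast
    then have "rep (inverse z) (g, f)" using False unfolding rep_def by auto
    then show ?thesis unfolding L'_def by blast
  qed (use that in auto)
  have neg: "- z \<in> L'" if "z \<in> L'" for z
  proof -
    obtain f g where r: "rep z (f, g)" using L'D[OF \<open>z \<in> L'\<close>] by blast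
    have "rep (- 1 * z) ([:-1:] * f, 1 * g)" by (rule rep_mult[OF rep_const r]) auto
    then show ?thesis unfolding L'_def by auto
  qed
  have ops: "z + w \<in> L'" "z * w \<in> L'" if zw: "z \<in> L'" "w \<in> L'" for z w
  proof -
    obtain f g h k where r: "rep z (f, g)" "rep w (h, k)" using L'D zw by blast
    show "z + w \<in> L'" unfolding L'_def using rep_add[OF r] by blast
    show "z * w \<in> L'" unfolding L'_def using rep_mult[OF r] by blast
  qed
  have "0 \<in> L'" "1 \<in> L'" using sub by auto
  then have "complex_subfield L'"
    unfolding complex_subfield_def using inv neg ops by simp
  moreover have "field_embedding_on L' \<sigma>'"
    unfolding field_embedding_on_def using hom_add' hom_mult' restr[of 1] by simp
  moreover have "x \<in> L'"
  proof -
    have "rep x ([:0, 1:], 1)"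
      unfolding rep_def by (auto simp: polys_def coeff_pCons split: nat.splits)
    then show ?thesis unfolding L'_def by blast
  qed
  moreover have "countable L'"
  proof -
    have "L' \<subseteq> (\<lambda>(f, g). poly f x / poly g x) ` (polys \<times> polys)"
      unfolding L'_def rep_def by auto
    moreover have "countable (polys \<times> polys)"
      using countable_polys[OF assms] by simp
    ultimately show ?thesis by (rule countable_subset[OF _ countable_image])
  qed
  ultimately show ?thesis using sub restr unfolding subfield_embedding_def by blast
qed

end

lemma extend_to_finite_set:
  assumes "subfield_embedding L \<sigma>" "countable L" "finite X"
  shows "\<exists>L' \<sigma>'. countable L' \<and> subfield_embedding L' \<sigma>' \<and> L \<subseteq> L' \<and> X \<subseteq> L' \<and> (\<forall>z\<in>L. \<sigma>' z = \<sigma> z)"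
  using assms(3)
proof induction
  case empty
  then show ?case using assms by blast
next
  case (insert x X)
  then obtain L' \<sigma>' where L': "countable L'" "subfield_embedding L' \<sigma>'" "L \<subseteq> L'" "X \<subseteq> L'"
    "\<forall>z\<in>L. \<sigma>' z = \<sigma> z" by blast
  then obtain L'' \<sigma>'' where "countable L''" "subfield_embedding L'' \<sigma>''" "L' \<subseteq> L''" "x \<in> L''"
    "\<forall>z\<in>L'. \<sigma>'' z = \<sigma>' z"
    using subfield_embedding.extend_to_element by meson
  then show ?case using L' by (intro exI[of _ L''] exI[of _ \<sigma>'']) auto
qed

section \<open>Embeddings of totally real and CM fields\<close>

text \<open>The inclusion is itself an embedding, so both \<open>K\<close> and its image are real
  and \<open>cnj\<close> is trivial on each.\<close>

lemma totally_real_commutes_cnj: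
  assumes "totally_real_field K" "field_embedding_on K \<sigma>" "z \<in> K"
  shows "cnj z \<in> K \<and> \<sigma> (cnj z) = cnj (\<sigma> z)"
proof -
  have "field_embedding_on K id" by (simp add: field_embedding_on_def)
  then have "id ` K \<subseteq> \<real>" using assms(1) unfolding totally_real_field_def by blast
  then have "z \<in> \<real>" using assms(3) by auto
  moreover have "\<sigma> z \<in> \<real>" using assms unfolding totally_real_field_def by blast
  ultimately show ?thesis using assms(3) by (metis Reals_cnj_iff)
qed

text \<open>A nonreal \<open>u\<close> in \<open>K\<close> satisfies a quadratic equation over the
  real field \<open>K0\<close>, so \<open>cnj u\<close> is its other root, \<open>b - u\<close>. The
  image of \<open>u\<close> is nonreal too and satisfies the conjugated equation, so its complex
  conjugate is given by the same formula; the rest follows by writing elements as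
  \<open>x + y * u\<close>.\<close>

lemma CM_field_commutes_cnj:
  assumes "CM_field K" "field_embedding_on K \<sigma>" "z \<in> K"
  shows "cnj z \<in> K \<and> \<sigma> (cnj z) = cnj (\<sigma> z)"
proof -
  have ti: "totally_imaginary_field K" using assms(1) unfolding CM_field_def by blast
  obtain K0 where K0: "totally_real_field K0" and quad: "quadratic_extension K0 K"
    using assms(1) unfolding CM_field_def by blast
  have subK0: "complex_subfield K0" and subK: "complex_subfield K" and K0K: "K0 \<subseteq> K"
    using quad unfolding quadratic_extension_def by auto
  interpret K: subfield_embedding K \<sigma> using subK assms(2) by unfold_locales
  obtain v w where vw: "v \<in> K" "w \<in> K" "\<And>z. z \<in> K \<Longrightarrow> \<exists>x\<in>K0. \<exists>y\<in>K0. z = x * v + y * w"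
    using quad unfolding quadratic_extension_def by blast
  note K0_closed = complex_subfieldD[OF subK0]
  have id: "field_embedding_on A id" for A by (simp add: field_embedding_on_def)
  have K0_real: "x \<in> \<real>" "\<sigma> x \<in> \<real>" if "x \<in> K0" for x
  proof -
    have "id ` K0 \<subseteq> \<real>" "\<sigma> ` K0 \<subseteq> \<real>"
      using K0 id[of K0] field_embedding_on_subset[OF assms(2) K0K] unfolding totally_real_field_def by blast+
    then show "x \<in> \<real>" "\<sigma> x \<in> \<real>" using that by auto
  qed
  obtain u where u: "u \<in> K" "u \<notin> \<real>"
  proof -
    have "\<not> id ` K \<subseteq> \<real>" using ti id[of K] unfolding totally_imaginary_field_def by blast
    then show thesis using that by auto
  qed
  have span: "\<exists>x\<in>K0. \<exists>y\<in>K0. z = x + y * u" if u: "u \<in> K" "u \<notin> \<real>" and z: "z \<in> K" for u z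
  proof -
    obtain p q where pq: "p \<in> K0" "q \<in> K0" "1 = p * v + q * w" using vw(3)[of 1] by auto
    obtain r s where rs: "r \<in> K0" "s \<in> K0" "u = r * v + s * w" using vw(3)[of u] u by auto
    obtain a b where ab: "a \<in> K0" "b \<in> K0" "z = a * v + b * w" using vw(3)[of z] z by auto
    \<comment> \<open>This is the determinant expressing \<open>1\<close> and \<open>u\<close> in
      the given basis. If it vanished, \<open>u\<close> would be a quotient of two elements of
      \<open>K0\<close>, hence real. Cramer's rule then gives the coordinates with respect to
      \<open>1\<close> and \<open>u\<close>.\<close>
    have "p * s - q * r \<noteq> 0"
    proof
      assume d: "p * s - q * r = 0"
      have "p * u = (p * s - q * r) * w + r * (p * v + q * w)" and "q * u = s * (p * v + q * w) - (p * s - q * r) * v"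
        unfolding rs(3) by (simp_all add: algebra_simps)
      then have "p * u = r" "q * u = s" using d pq by auto
      then have "p = 0" "q = 0"
        using K0_real(1) rs pq(1,2) u(2) by (metis Reals_divide nonzero_mult_div_cancel_left)+
      then show False using pq by simp
    qed
    moreover have "(p * s - q * r) * z = (a * s - b * r) * (p * v + q * w) + (b * p - a * q) * (r * v + s * w)"
      unfolding ab(3) by (simp add: algebra_simps)
    then have "(p * s - q * r) * z = (a * s - b * r) + (b * p - a * q) * u"
      unfolding pq(3)[symmetric] rs(3)[symmetric] by simp
    ultimately have "z = (a * s - b * r) / (p * s - q * r) + (b * p - a * q) / (p * s - q * r) * u"
      by (simp add: nonzero_eq_divide_eq add_divide_distrib[symmetric] mult.commute)
    moreover have "(a * s - b * r) / (p * s - q * r) \<in> K0" "(b * p - a * q) / (p * s - q * r) \<in> K0"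
      using pq(1,2) rs(1,2) ab(1,2) by (simp_all add: K0_closed)
    ultimately show ?thesis by blast
  qed
  \<comment> \<open>Otherwise \<open>\<sigma>\<close> would map all of \<open>K\<close> into the
    reals, which a totally imaginary field excludes.\<close>
  have nonreal: "\<sigma> u \<notin> \<real>"
  proof
    assume r: "\<sigma> u \<in> \<real>"
    have "\<sigma> z \<in> \<real>" if z: "z \<in> K" for z
    proof -
      obtain x y where "x \<in> K0" "y \<in> K0" "z = x + y * u" using span[OF u z] by blast
      moreover from this have "x \<in> K" "y \<in> K" using K0K by auto
      ultimately show ?thesis using r K0_real(2) u(1) by (simp add: K.add K.mult)
    qed
    then show False using ti assms(2) unfolding totally_imaginary_field_def by blast
  qed
  obtain b c where bc: "b \<in> K0" "c \<in> K0" "u * u = c + b * u"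
    using span[OF u complex_subfieldD(4)[OF subK u(1) u(1)]] by blast
  have other_root: "cnj t = B - t" if "t * t = C + B * t" "B \<in> \<real>" "C \<in> \<real>" "t \<notin> \<real>" for t B C
  proof -
    have "cnj t * cnj t = C + B * cnj t" using arg_cong[OF that(1), of cnj] that(2,3) by (simp add: Reals_cnj_iff)
    then have "(t - cnj t) * (t + cnj t - B) = 0" using that(1) by (simp add: algebra_simps)
    moreover have "t - cnj t \<noteq> 0" using that(4) by (simp add: Reals_cnj_iff)
    ultimately have "t + cnj t - B = 0" by simp
    then show ?thesis by (simp add: algebra_simps)
  qed
  have cu: "cnj u = b - u" using other_root[OF bc(3)] K0_real bc(1,2) u(2) by simp
  have "\<sigma> u * \<sigma> u = \<sigma> c + \<sigma> b * \<sigma> u"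
    using arg_cong[OF bc(3), of \<sigma>] bc(1,2) subsetD[OF K0K] u(1) by (simp add: K.add K.mult)
  then have csu: "cnj (\<sigma> u) = \<sigma> b - \<sigma> u" using other_root[of "\<sigma> u"] K0_real bc(1,2) nonreal by simp
  obtain x y where xy: "x \<in> K0" "y \<in> K0" "z = x + y * u" using span[OF u assms(3)] by blast
  have inK: "x \<in> K" "y \<in> K" "b \<in> K" "u \<in> K" using xy(1,2) bc(1) K0K u(1) by auto
  have cz: "cnj z = x + y * (b - u)"
    using xy(3) cu K0_real(1)[OF xy(1)] K0_real(1)[OF xy(2)] by (simp add: Reals_cnj_iff)
  have "cnj (\<sigma> z) = \<sigma> x + \<sigma> y * (\<sigma> b - \<sigma> u)"
    using xy(3) csu inK K0_real(2)[OF xy(1)] K0_real(2)[OF xy(2)] by (simp add: Reals_cnj_iff K.add K.mult)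
  then show ?thesis using cz inK by (simp add: K.add K.mult K.diff)
qed

section \<open>Braidings with unitary associator are unitary\<close>

lemma sum_single:
  assumes "finite A" "k \<in> A" "\<And>i. i \<in> A \<Longrightarrow> i \<noteq> k \<Longrightarrow> g i = 0"
  shows "sum g A = g k"
  using sum.mono_neutral_right[of A "{k}" g] assms by auto

lemma sum_mult_of_bool_single:
  fixes f :: "'i \<Rightarrow> 'b::semiring_1"
  assumes "finite I" "k \<in> I"
  shows "(\<Sum>i\<in>I. f i * of_bool (i = k)) = f k" "(\<Sum>i\<in>I. f i * of_bool (k = i)) = f k"
    "(\<Sum>i\<in>I. of_bool (i = k) * f i) = f k" "(\<Sum>i\<in>I. of_bool (k = i) * f i) = f k"
  by (subst sum_single[where k = k]; use assms in simp)+

lemma unitary_rows: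
  assumes "unitary_matrix_on I J A" "i \<in> I" "i' \<in> I"
  shows "(\<Sum>j\<in>J. A i j * cnj (A i' j)) = of_bool (i = i')"
  using assms unfolding unitary_matrix_on_def inverse_matrices_on_def by blast

lemma unitary_cols:
  assumes "unitary_matrix_on I J A" "j \<in> J" "j' \<in> J"
  shows "(\<Sum>i\<in>I. cnj (A i j) * A i j') = of_bool (j = j')"
  using assms unfolding unitary_matrix_on_def inverse_matrices_on_def by blast

lemma unitary_solve_left:
  assumes "unitary_matrix_on I J A" "finite I"
    and "\<And>j. j \<in> J \<Longrightarrow> (\<Sum>i\<in>I. X i * A i j) = Y j" and i: "i \<in> I"
  shows "X i = (\<Sum>j\<in>J. Y j * cnj (A i j))"
proof -
  have "(\<Sum>j\<in>J. Y j * cnj (A i j)) = (\<Sum>j\<in>J. \<Sum>i'\<in>I. X i' * (A i' j * cnj (A i j)))"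
    by (intro sum.cong) (simp_all add: assms(3)[symmetric] sum_distrib_right mult.assoc)
  also have "\<dots> = (\<Sum>i'\<in>I. X i' * (\<Sum>j\<in>J. A i' j * cnj (A i j)))"
    by (subst sum.swap) (simp add: sum_distrib_left)
  also have "\<dots> = (\<Sum>i'\<in>I. X i' * of_bool (i' = i))"
    by (intro sum.cong refl) (simp add: unitary_rows[OF assms(1) _ i])
  also have "\<dots> = X i" by (rule sum_mult_of_bool_single[OF assms(2) i])
  finally show ?thesis by simp
qed

lemma unitary_solve_right:
  assumes "unitary_matrix_on I J A" "finite J"
    and "\<And>i. i \<in> I \<Longrightarrow> (\<Sum>j\<in>J. A i j * X j) = Y i" and j: "j \<in> J"
  shows "X j = (\<Sum>i\<in>I. cnj (A i j) * Y i)"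
proof -
  have "(\<Sum>i\<in>I. cnj (A i j) * Y i) = (\<Sum>i\<in>I. \<Sum>j'\<in>J. (cnj (A i j) * A i j') * X j')"
    by (intro sum.cong) (simp_all add: assms(3)[symmetric] sum_distrib_left mult.assoc)
  also have "\<dots> = (\<Sum>j'\<in>J. (\<Sum>i\<in>I. cnj (A i j) * A i j') * X j')"
    by (subst sum.swap) (simp add: sum_distrib_right)
  also have "\<dots> = (\<Sum>j'\<in>J. of_bool (j = j') * X j')"
    by (intro sum.cong refl) (simp add: unitary_cols[OF assms(1) j])
  also have "\<dots> = X j" by (rule sum_mult_of_bool_single[OF assms(2) j])
  finally show ?thesis by simp
qed

lemma unitary_norm_left:
  assumes "unitary_matrix_on I J A" "finite J"
  shows "(\<Sum>i\<in>I. (cmod (\<Sum>j\<in>J. A i j * x j))\<^sup>2) = (\<Sum>j\<in>J. (cmod (x j))\<^sup>2)"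
proof -
  have "complex_of_real (\<Sum>i\<in>I. (cmod (\<Sum>j\<in>J. A i j * x j))\<^sup>2) =
      (\<Sum>i\<in>I. (\<Sum>j\<in>J. A i j * x j) * cnj (\<Sum>j\<in>J. A i j * x j))"
    by (simp only: of_real_sum complex_norm_square)
  also have "\<dots> = (\<Sum>i\<in>I. \<Sum>j\<in>J. (cnj (x j) * cnj (A i j)) * (\<Sum>j\<in>J. A i j * x j))"
    by (simp add: sum_distrib_left sum_distrib_right mult_ac)
  also have "\<dots> = (\<Sum>j\<in>J. cnj (x j) * (\<Sum>i\<in>I. cnj (A i j) * (\<Sum>j\<in>J. A i j * x j)))"
    by (subst sum.swap) (simp add: sum_distrib_left mult.assoc)
  also have "\<dots> = (\<Sum>j\<in>J. cnj (x j) * x j)"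
    by (intro sum.cong refl arg_cong[where f = "(*) _"] unitary_solve_right[OF assms, symmetric]) auto
  also have "\<dots> = complex_of_real (\<Sum>j\<in>J. (cmod (x j))\<^sup>2)"
    by (simp only: of_real_sum complex_norm_square mult.commute)
  finally show ?thesis by (simp only: of_real_eq_iff)
qed

lemma unitary_norm_right:
  assumes "unitary_matrix_on I J A" "finite I"
  shows "(\<Sum>j\<in>J. (cmod (\<Sum>i\<in>I. x i * A i j))\<^sup>2) = (\<Sum>i\<in>I. (cmod (x i))\<^sup>2)"
proof -
  have "unitary_matrix_on J I (\<lambda>j i. A i j)"
    using assms(1) unfolding unitary_matrix_on_def inverse_matrices_on_def
    by (auto simp: mult.commute)
  from unitary_norm_left[OF this assms(2), of x] show ?thesis by (simp add: mult.commute)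
qed

lemma F_rows_eq_Sigma:
  "F_rows C a b c d = Sigma UNIV (\<lambda>e. {..<fus C a b e} \<times> {..<fus C e c d})"
  by (auto simp: F_rows_def)

lemma F_cols_eq_Sigma:
  "F_cols C a b c d = Sigma UNIV (\<lambda>f. {..<fus C b c f} \<times> {..<fus C a f d})"
  by (auto simp: F_cols_def)

lemma finite_F_rows [simp]: "finite (F_rows (C :: ('a::finite) mtc_data) a b c d)"
  and finite_F_cols [simp]: "finite (F_cols (C :: ('a::finite) mtc_data) a b c d)"
  unfolding F_rows_eq_Sigma F_cols_eq_Sigma by auto

lemma sum_F_rows:
  fixes C :: "('a::finite) mtc_data"
  shows "(\<Sum>i\<in>F_rows C a b c d. g i) = (\<Sum>e\<in>UNIV. \<Sum>\<alpha><fus C a b e. \<Sum>\<beta><fus C e c d. g (e, \<alpha>, \<beta>))"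
  by (simp add: F_rows_eq_Sigma sum.cartesian_product sum.Sigma split_def)

lemma sum_F_cols:
  fixes C :: "('a::finite) mtc_data"
  shows "(\<Sum>j\<in>F_cols C a b c d. g j) = (\<Sum>f\<in>UNIV. \<Sum>\<mu><fus C b c f. \<Sum>\<nu><fus C a f d. g (f, \<mu>, \<nu>))"
  by (simp add: F_cols_eq_Sigma sum.cartesian_product sum.Sigma split_def)

lemma mem_F_rows [simp]: "(e, \<alpha>, \<beta>) \<in> F_rows C a b c d \<longleftrightarrow> \<alpha> < fus C a b e \<and> \<beta> < fus C e c d"
  and mem_F_cols [simp]: "(f, \<mu>, \<nu>) \<in> F_cols C a b c d \<longleftrightarrow> \<mu> < fus C b c f \<and> \<nu> < fus C a f d"
  by (auto simp: F_rows_def F_cols_def)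

section \<open>Bending and rotating legs of fusion vertices when \<open>F\<close> is unitary\<close>

locale unitary_F_mtc =
  fixes C :: "('a::finite) mtc_data"
  assumes mtc: "modular_tensor_category C"
    and F_unitary: "F_unitary C"
    and qdim_pos: "qdim C a \<in> \<real>" "0 < Re (qdim C a)"
begin

abbreviation "N \<equiv> fus C"
abbreviation "st \<equiv> dual C"
abbreviation "v \<equiv> vac C"
abbreviation "F \<equiv> Fsym C"

definition d :: "'a \<Rightarrow> real" where "d a = Re (qdim C a)"

text \<open>The scalar of the zigzag on \<open>a\<close>, which \<open>\<phi>_eq\<close> evaluates
  as a sign over the dimension.\<close>

definition \<phi> :: "'a \<Rightarrow> complex" where "\<phi> a = F a (st a) a a (v, 0, 0) (v, 0, 0)"

text \<open>Up to normalisation, \<open>B\<close> bends the leg \<open>y\<close> of a vector of \<open>Hom(h, y x)\<close> down to the left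
  and \<open>D\<close> bends the leg \<open>x\<close> down to the right, while \<open>P\<close> rotates \<open>Hom(1, a b c)\<close>.\<close>

definition B :: "'a \<Rightarrow> 'a \<Rightarrow> 'a \<Rightarrow> nat \<Rightarrow> nat \<Rightarrow> complex" where
  "B y x h \<eta> \<psi> = F (st y) y x x (v, 0, 0) (h, \<eta>, \<psi>)"

definition D :: "'a \<Rightarrow> 'a \<Rightarrow> 'a \<Rightarrow> nat \<Rightarrow> nat \<Rightarrow> complex" where
  "D y x h \<eta> \<rho> = F y x (st x) y (h, \<eta>, \<rho>) (v, 0, 0)"

definition P :: "'a \<Rightarrow> 'a \<Rightarrow> 'a \<Rightarrow> nat \<Rightarrow> nat \<Rightarrow> complex" where
  "P a b c \<alpha> \<mu> = F a b c v (st c, \<alpha>, 0) (st a, \<mu>, 0)"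

lemma N_vac [simp]: "N v a b = of_bool (a = b)" "N a v b = of_bool (a = b)"
    "N a b v = of_bool (b = st a)"
  and dual_dual [simp]: "st (st a) = a"
  using mtc unfolding modular_tensor_category_def fusion_rules_def by blast+

lemma st_inj [simp]: "st a = st b \<longleftrightarrow> a = b"
  using dual_dual by metis

lemma F_uni: "unitary_matrix_on (F_rows C a b c z) (F_cols C a b c z) (F a b c z)"
  using F_unitary unfolding F_unitary_def by blast

lemma triangle_left:
  "\<beta> < N b c z \<Longrightarrow> \<mu> < N b c z \<Longrightarrow> F v b c z (b, 0, \<beta>) (z, \<mu>, 0) = of_bool (\<beta> = \<mu>)"
  and triangle_mid:
  "\<beta> < N b c z \<Longrightarrow> \<mu> < N b c z \<Longrightarrow> F b v c z (b, 0, \<beta>) (c, 0, \<mu>) = of_bool (\<beta> = \<mu>)"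
  and triangle_right:
  "\<beta> < N b c z \<Longrightarrow> \<mu> < N b c z \<Longrightarrow> F b c v z (z, \<beta>, 0) (c, 0, \<mu>) = of_bool (\<beta> = \<mu>)"
  using mtc unfolding modular_tensor_category_def triangle_def by blast+

lemma pentagon_eq:
  assumes "\<alpha> < N a b f" "\<beta> < N f c g" "\<gamma> < N g z e" "\<delta> < N c z l" "\<kappa> < N b l k" "\<mu> < N a k e"
  shows "(\<Sum>\<sigma><N f l e. F f c z e (g, \<beta>, \<gamma>) (l, \<delta>, \<sigma>) * F a b l e (f, \<alpha>, \<sigma>) (k, \<kappa>, \<mu>)) =
        (\<Sum>h\<in>UNIV. \<Sum>\<eta><N b c h. \<Sum>\<psi><N a h g. \<Sum>\<rho><N h z k.
            F a b c g (f, \<alpha>, \<beta>) (h, \<eta>, \<psi>) * F a h z e (g, \<psi>, \<gamma>) (k, \<rho>, \<mu>) *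
            F b c z k (h, \<eta>, \<rho>) (l, \<delta>, \<kappa>))"
  using mtc assms unfolding modular_tensor_category_def pentagon_def by blast

lemma qdim_eq: "qdim C a = of_real (d a)"
  and d_pos [simp]: "0 < d a"
  using qdim_pos[of a] by (auto simp: d_def complex_is_Real_iff complex_eq_iff)

lemma d_nonzero [simp]: "d a \<noteq> 0"
  by (metis d_pos less_irrefl)

lemma piv_cases: "piv C a = 1 \<or> piv C a = - 1"
  using mtc unfolding modular_tensor_category_def pivotal_def by blast

lemma \<phi>_eq: "\<phi> a = piv C a / of_real (d a)"
proof -
  have "\<phi> a \<noteq> 0"
    using mtc unfolding modular_tensor_category_def rigid_def \<phi>_def by blast
  moreover have "piv C a / \<phi> a = of_real (d a)"
    using qdim_eq[of a] by (simp add: qdim_def \<phi>_def)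
  ultimately show ?thesis by (simp add: field_simps)
qed

text \<open>The pentagon for \<open>st y\<close>, \<open>y\<close>, \<open>x\<close>,
  \<open>z\<close> with the first pair fused to the vacuum. The triangle axiom collapses its left
  side to the channel \<open>f\<close>, and unitarity of \<open>F y x z k\<close> carries the last
  factor to the other side as a conjugate.\<close>

lemma bend_move:
  assumes "\<eta> < N y x h" "\<gamma> < N x z f" "\<rho> < N h z k" "\<mu> < N (st y) k f"
  shows "(\<Sum>\<psi><N (st y) h x. B y x h \<eta> \<psi> * F (st y) h z f (x, \<psi>, \<gamma>) (k, \<rho>, \<mu>)) =
    (\<Sum>\<kappa><N y f k. B y f k \<kappa> \<mu> * cnj (F y x z k (h, \<eta>, \<rho>) (f, \<gamma>, \<kappa>)))"
proof -
  define X where "X = (\<lambda>(h, \<eta>, \<rho>). \<Sum>\<psi><N (st y) h x. B y x h \<eta> \<psi> * F (st y) h z f (x, \<psi>, \<gamma>) (k, \<rho>, \<mu>))"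
  define Y where "Y = (\<lambda>(l, \<delta>, \<kappa>). of_bool (l = f \<and> \<delta> = \<gamma>) * B y f k \<kappa> \<mu>)"
  have XY: "(\<Sum>i\<in>F_rows C y x z k. X i * F y x z k i j) = Y j" if j: "j \<in> F_cols C y x z k" for j
  proof -
    obtain l \<delta> \<kappa> where jj: "j = (l, \<delta>, \<kappa>)" by (cases j)
    then have lt: "\<delta> < N x z l" "\<kappa> < N y l k" using j by auto
    have "(\<Sum>i\<in>F_rows C y x z k. X i * F y x z k i j) = (\<Sum>h\<in>UNIV. \<Sum>\<eta><N y x h. \<Sum>\<psi><N (st y) h x. \<Sum>\<rho><N h z k.
        F (st y) y x x (v, 0, 0) (h, \<eta>, \<psi>) * F (st y) h z f (x, \<psi>, \<gamma>) (k, \<rho>, \<mu>) *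
        F y x z k (h, \<eta>, \<rho>) (l, \<delta>, \<kappa>))"
      unfolding sum_F_rows jj X_def split B_def sum_distrib_right
      by (intro sum.cong refl sum.swap)
    also have "\<dots> = (\<Sum>\<sigma><N v l f. F v x z f (x, 0, \<gamma>) (l, \<delta>, \<sigma>) * F (st y) y l f (v, 0, \<sigma>) (k, \<kappa>, \<mu>))"
      by (rule pentagon_eq[symmetric]) (use assms lt in auto)
    also have "\<dots> = Y j"
    proof (cases "l = f")
      case True
      then show ?thesis using lt assms triangle_left[of \<gamma> x z f \<delta>] by (auto simp: Y_def jj B_def)
    qed (simp add: Y_def jj)
    finally show ?thesis .
  qed
  have "X (h, \<eta>, \<rho>) = (\<Sum>j\<in>F_cols C y x z k. Y j * cnj (F y x z k (h, \<eta>, \<rho>) j))"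
    by (rule unitary_solve_left[OF F_uni _ XY]) (use assms in auto)
  also have "\<dots> = (\<Sum>\<kappa><N y f k. B y f k \<kappa> \<mu> * cnj (F y x z k (h, \<eta>, \<rho>) (f, \<gamma>, \<kappa>)))"
    unfolding sum_F_cols
    by (subst sum_single[where k = f], simp, simp, simp add: Y_def, subst sum_single[where k = \<gamma>])
      (use assms in \<open>auto simp: Y_def\<close>)
  finally show ?thesis by (simp add: X_def)
qed

text \<open>The case of \<open>bend_move\<close> in which \<open>st y\<close> and \<open>y\<close>
  fuse to the vacuum: bending a leg down and up again is a zigzag, hence the scalar
  \<open>\<phi> y\<close>.\<close>

lemma B_bend_back:
  assumes "\<gamma> < N y x h" "\<mu> < N y x h"
  shows "(\<Sum>\<kappa><N (st y) h x. cnj (B y x h \<gamma> \<kappa>) * B (st y) h x \<kappa> \<mu>) = \<phi> y * of_bool (\<gamma> = \<mu>)"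
  using bend_move[of 0 "st y" y v \<gamma> x h 0 x \<mu>] assms
  by (simp add: B_def \<phi>_def triangle_mid mult.commute)

text \<open>The case of \<open>bend_move\<close> with vacuum total charge: a left bend followed by a
  rotation is a right bend.\<close>

lemma B_times_P:
  assumes "\<eta> < N y x h" "\<rho> < N h (st x) y"
  shows "(\<Sum>\<psi><N (st y) h x. B y x h \<eta> \<psi> * P (st y) h (st x) \<psi> \<rho>) = cnj (D y x h \<eta> \<rho>)"
  using bend_move[of \<eta> y x h 0 "st x" v \<rho> y 0] assms triangle_right[of 0 "st y" y v 0]
  by (simp add: B_def P_def D_def)

text \<open>The mirror image of \<open>B_bend_back\<close>, from the pentagon for \<open>y\<close>,
  \<open>x\<close>, \<open>st x\<close>, \<open>x\<close> with the last pair fused to the vacuum;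
  this time unitarity is used to solve for a vector on the column side.\<close>

lemma D_bend_back:
  assumes "\<gamma> < N y x h" "\<mu> < N y x h"
  shows "(\<Sum>\<beta><N h (st x) y. cnj (D y x h \<mu> \<beta>) * D h (st x) y \<beta> \<gamma>) = \<phi> x * of_bool (\<gamma> = \<mu>)"
proof -
  define X where "X = (\<lambda>(h', \<eta>, \<psi>). \<Sum>\<rho><N h' x x. F y h' x h (y, \<psi>, \<gamma>) (x, \<rho>, \<mu>) * F x (st x) x x (h', \<eta>, \<rho>) (v, 0, 0))"
  define Y where "Y = (\<lambda>(h', \<alpha>, \<beta>). of_bool (h' = h \<and> \<alpha> = \<mu>) * D h (st x) y \<beta> \<gamma>)"
  have XY: "(\<Sum>j\<in>F_cols C y x (st x) y. F y x (st x) y i j * X j) = Y i" if i: "i \<in> F_rows C y x (st x) y" for i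
  proof -
    obtain h' \<alpha> \<beta> where ii: "i = (h', \<alpha>, \<beta>)" by (cases i)
    then have lt: "\<alpha> < N y x h'" "\<beta> < N h' (st x) y" using i by auto
    have "(\<Sum>j\<in>F_cols C y x (st x) y. F y x (st x) y i j * X j) =
        (\<Sum>h''\<in>UNIV. \<Sum>\<eta><N x (st x) h''. \<Sum>\<psi><N y h'' y. \<Sum>\<rho><N h'' x x.
          F y x (st x) y (h', \<alpha>, \<beta>) (h'', \<eta>, \<psi>) * F y h'' x h (y, \<psi>, \<gamma>) (x, \<rho>, \<mu>) *
          F x (st x) x x (h'', \<eta>, \<rho>) (v, 0, 0))"
      unfolding sum_F_cols ii X_def split sum_distrib_left mult.assoc ..
    also have "\<dots> = (\<Sum>\<sigma><N h' v h. F h' (st x) x h (y, \<beta>, \<gamma>) (v, 0, \<sigma>) * F y x v h (h', \<alpha>, \<sigma>) (x, 0, \<mu>))"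
      by (rule pentagon_eq[symmetric]) (use assms lt in auto)
    also have "\<dots> = Y i"
    proof (cases "h' = h")
      case True
      then show ?thesis using lt assms triangle_right[of \<alpha> y x h \<mu>] by (auto simp: Y_def ii D_def)
    qed (simp add: Y_def ii)
    finally show ?thesis .
  qed
  have "X (v, 0, 0) = (\<Sum>i\<in>F_rows C y x (st x) y. cnj (F y x (st x) y i (v, 0, 0)) * Y i)"
    by (rule unitary_solve_right[OF F_uni _ XY]) auto
  also have "\<dots> = (\<Sum>\<beta><N h (st x) y. cnj (D y x h \<mu> \<beta>) * D h (st x) y \<beta> \<gamma>)"
    unfolding sum_F_rows
    by (subst sum_single[where k = h], simp, simp, simp add: Y_def, subst sum_single[where k = \<mu>])
      (use assms in \<open>auto simp: Y_def D_def\<close>)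
  finally show ?thesis
    using assms by (simp add: X_def \<phi>_def triangle_mid mult.commute)
qed

text \<open>The pentagon for \<open>h\<close>, \<open>st x\<close>, \<open>st y\<close>,
  \<open>h\<close> with the first three and the last three fused to the vacuum. Its long side
  consists of two rotations with the zigzag of \<open>h\<close> between them, its short side of a
  right and a left bend.\<close>

lemma P_times_P:
  assumes "\<alpha> < N h (st x) y" "\<delta> < N (st y) h x"
  shows "\<phi> h * (\<Sum>\<beta><N (st x) (st y) (st h). P h (st x) (st y) \<alpha> \<beta> * P (st x) (st y) h \<beta> \<delta>) =
    (\<Sum>\<sigma><N y x h. D h (st x) y \<alpha> \<sigma> * B (st y) h x \<delta> \<sigma>)"
proof -
  have "(\<Sum>\<sigma><N y x h. F y (st y) h h (v, 0, 0) (x, \<delta>, \<sigma>) * F h (st x) x h (y, \<alpha>, \<sigma>) (v, 0, 0)) =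
        (\<Sum>h'\<in>UNIV. \<Sum>\<eta><N (st x) (st y) h'. \<Sum>\<psi><N h h' v. \<Sum>\<rho><N h' h v.
            F h (st x) (st y) v (y, \<alpha>, 0) (h', \<eta>, \<psi>) * F h h' h h (v, \<psi>, 0) (v, \<rho>, 0) *
            F (st x) (st y) h v (h', \<eta>, \<rho>) (x, \<delta>, 0))"
    by (rule pentagon_eq) (use assms in auto)
  also have "\<dots> = (\<Sum>\<eta><N (st x) (st y) (st h). F h (st x) (st y) v (y, \<alpha>, 0) (st h, \<eta>, 0) * \<phi> h *
            F (st x) (st y) h v (st h, \<eta>, 0) (x, \<delta>, 0))"
    by (subst sum_single[where k = "st h"]) (auto simp: \<phi>_def)
  finally show ?thesis
    by (simp add: P_def B_def D_def sum_distrib_left mult_ac)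
qed

text \<open>With vacuum total charge the intermediate charges are forced, so \<open>P\<close> is the
  whole of an \<open>F\<close> matrix rather than a block of it.\<close>

lemma P_unitary: "unitary_matrix_on {..<N (st y) h x} {..<N h (st x) y} (P (st y) h (st x))"
proof -
  let ?P = "P (st y) h (st x)"
  have single: "(\<Sum>e\<in>UNIV. \<Sum>\<beta><N a b e. \<Sum>\<nu><of_bool (c = e). g e \<beta> \<nu>) = (\<Sum>\<beta><N a b c. g c \<beta> 0)"
    for a b c and g :: "'a \<Rightarrow> nat \<Rightarrow> nat \<Rightarrow> complex"
    by (subst sum_single[where k = c]) auto
  have single': "(\<Sum>e\<in>UNIV. \<Sum>\<beta><N a b e. \<Sum>\<nu><of_bool (e = c). g e \<beta> \<nu>) = (\<Sum>\<beta><N a b c. g c \<beta> 0)"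
    for a b c and g :: "'a \<Rightarrow> nat \<Rightarrow> nat \<Rightarrow> complex"
    by (subst sum_single[where k = c]) auto
  show ?thesis
    unfolding unitary_matrix_on_def inverse_matrices_on_def
  proof (intro conjI ballI)
    fix \<psi> \<psi>' assume "\<psi> \<in> {..<N (st y) h x}" "\<psi>' \<in> {..<N (st y) h x}"
    then show "(\<Sum>\<rho><N h (st x) y. ?P \<psi> \<rho> * cnj (?P \<psi>' \<rho>)) = of_bool (\<psi> = \<psi>')"
      using unitary_rows[OF F_uni, of "(x, \<psi>, 0)" "st y" h "st x" v "(x, \<psi>', 0)"]
      by (simp add: sum_F_cols single' P_def)
  next
    fix \<rho> \<rho>' assume "\<rho> \<in> {..<N h (st x) y}" "\<rho>' \<in> {..<N h (st x) y}"
    then show "(\<Sum>\<psi><N (st y) h x. cnj (?P \<psi> \<rho>) * ?P \<psi> \<rho>') = of_bool (\<rho> = \<rho>')"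
      using unitary_cols[OF F_uni, of "(y, \<rho>, 0)" "st y" h "st x" v "(y, \<rho>', 0)"]
      by (simp add: sum_F_rows single P_def)
  qed
qed

lemma P_cycle:
  assumes "\<alpha> < N a b (st c)" "\<alpha>' < N a b (st c)"
  shows "(\<Sum>\<mu><N b c (st a). \<Sum>\<nu><N c a (st b). P a b c \<alpha> \<mu> * P b c a \<mu> \<nu> * P c a b \<nu> \<alpha>') =
    piv C a * piv C b * piv C c * of_bool (\<alpha> = \<alpha>')"
  using mtc assms unfolding modular_tensor_category_def pivotal_def P_def by blast

text \<open>By the pivotal axiom three rotations make a sign, so two of them equal that sign times
  the inverse of the third, which is its adjoint.\<close>

lemma P_rotation:
  assumes "\<alpha> < N h (st x) y" "\<delta> < N (st y) h x"
  shows "(\<Sum>\<beta><N (st x) (st y) (st h). P h (st x) (st y) \<alpha> \<beta> * P (st x) (st y) h \<beta> \<delta>) =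
    piv C h * piv C (st x) * piv C (st y) * cnj (P (st y) h (st x) \<delta> \<alpha>)"
proof -
  let ?P = "P (st y) h (st x)"
  let ?Q = "\<lambda>\<alpha> \<delta>. \<Sum>\<beta><N (st x) (st y) (st h). P h (st x) (st y) \<alpha> \<beta> * P (st x) (st y) h \<beta> \<delta>"
  have "?Q \<alpha> \<delta> = (\<Sum>\<alpha>'<N h (st x) y. (piv C h * piv C (st x) * piv C (st y) * of_bool (\<alpha> = \<alpha>')) * cnj (?P \<delta> \<alpha>'))"
  proof (rule unitary_solve_left[OF P_unitary])
    fix \<alpha>' assume "\<alpha>' \<in> {..<N h (st x) y}"
    then have "(\<Sum>\<mu><N (st x) (st y) (st h). \<Sum>\<nu><N (st y) h x. P h (st x) (st y) \<alpha> \<mu> * P (st x) (st y) h \<mu> \<nu> * ?P \<nu> \<alpha>') =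
       piv C h * piv C (st x) * piv C (st y) * of_bool (\<alpha> = \<alpha>')"
      using P_cycle[of \<alpha> h "st x" "st y" \<alpha>'] assms(1) by simp
    then show "(\<Sum>\<nu><N (st y) h x. ?Q \<alpha> \<nu> * ?P \<nu> \<alpha>') = piv C h * piv C (st x) * piv C (st y) * of_bool (\<alpha> = \<alpha>')"
      by (subst (asm) sum.swap) (simp add: sum_distrib_right)
  qed (use assms in auto)
  also have "\<dots> = piv C h * piv C (st x) * piv C (st y) * cnj (?P \<delta> \<alpha>)"
    by (subst sum_single[where k = \<alpha>]) (use assms in auto)
  finally show ?thesis .
qed

text \<open>\<open>B (st y) h x\<close> is inverse to the conjugate of \<open>B y x h\<close> by \<open>B_bend_back\<close> and a multiple of its transpose
  by the following lemma, which rests on the pivotal axiom; hence \<open>B\<close> is a multiple of a unitary.\<close>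

lemma B_transpose:
  assumes "\<mu> < N y x h" "\<delta> < N (st y) h x"
  shows "\<phi> h * (piv C h * piv C (st x) * piv C (st y)) * B y x h \<mu> \<delta> = \<phi> x * B (st y) h x \<delta> \<mu>"
proof -
  let ?s = "piv C h * piv C (st x) * piv C (st y)" and ?P = "P (st y) h (st x)"
  \<comment> \<open>\<open>B_times_P\<close> is solved for \<open>B\<close> by unitarity of
    \<open>?P\<close>. Replacing the conjugate of \<open>?P\<close> by two rotations then brings in
    \<open>D\<close> and \<open>B (st y) h x\<close>, and \<open>D_bend_back\<close> removes
    \<open>D\<close>.\<close>
  have "(\<Sum>\<alpha><N h (st x) y. cnj (D y x h \<mu> \<alpha>) * cnj (?P \<delta> \<alpha>)) =
    (\<Sum>\<alpha><N h (st x) y. \<Sum>\<psi><N (st y) h x. B y x h \<mu> \<psi> * (?P \<psi> \<alpha> * cnj (?P \<delta> \<alpha>)))"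
    using assms by (intro sum.cong) (simp_all add: B_times_P[symmetric] sum_distrib_right mult.assoc)
  also have "\<dots> = (\<Sum>\<psi><N (st y) h x. B y x h \<mu> \<psi> * (\<Sum>\<alpha><N h (st x) y. ?P \<psi> \<alpha> * cnj (?P \<delta> \<alpha>)))"
    by (subst sum.swap) (simp add: sum_distrib_left)
  also have "\<dots> = (\<Sum>\<psi><N (st y) h x. B y x h \<mu> \<psi> * of_bool (\<psi> = \<delta>))"
    using assms by (intro sum.cong refl) (simp add: unitary_rows[OF P_unitary])
  also have "\<dots> = B y x h \<mu> \<delta>"
    using assms by (intro sum_mult_of_bool_single) auto
  finally have *: "B y x h \<mu> \<delta> = (\<Sum>\<alpha><N h (st x) y. cnj (D y x h \<mu> \<alpha>) * cnj (?P \<delta> \<alpha>))" ..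
  have "\<phi> h * ?s * B y x h \<mu> \<delta> = (\<Sum>\<alpha><N h (st x) y. cnj (D y x h \<mu> \<alpha>) * (\<phi> h * (?s * cnj (?P \<delta> \<alpha>))))"
    unfolding * by (simp add: sum_distrib_left mult_ac)
  also have "\<dots> = (\<Sum>\<alpha><N h (st x) y. cnj (D y x h \<mu> \<alpha>) * (\<Sum>\<sigma><N y x h. D h (st x) y \<alpha> \<sigma> * B (st y) h x \<delta> \<sigma>))"
    using assms(2) by (intro sum.cong refl) (simp add: P_times_P[symmetric] P_rotation)
  also have "\<dots> = (\<Sum>\<alpha><N h (st x) y. \<Sum>\<sigma><N y x h. (cnj (D y x h \<mu> \<alpha>) * D h (st x) y \<alpha> \<sigma>) * B (st y) h x \<delta> \<sigma>)"
    by (simp add: sum_distrib_left mult.assoc)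
  also have "\<dots> = (\<Sum>\<sigma><N y x h. (\<Sum>\<alpha><N h (st x) y. cnj (D y x h \<mu> \<alpha>) * D h (st x) y \<alpha> \<sigma>) * B (st y) h x \<delta> \<sigma>)"
    by (subst sum.swap) (simp add: sum_distrib_right)
  also have "\<dots> = (\<Sum>\<sigma><N y x h. (\<phi> x * B (st y) h x \<delta> \<sigma>) * of_bool (\<sigma> = \<mu>))"
    using assms by (intro sum.cong refl) (simp add: D_bend_back)
  also have "\<dots> = \<phi> x * B (st y) h x \<delta> \<mu>"
    using assms by (intro sum_mult_of_bool_single) auto
  finally show ?thesis .
qed

text \<open>\<open>B_bend_back\<close> and \<open>B_transpose\<close> together give orthogonal rows
  whose squared length is \<open>d h / (d x * d y)\<close> up to a sign \<open>t\<close>, a product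
  of pivotal coefficients. A squared length cannot be negative, and all dimensions are positive, so
  the sign is \<open>1\<close>.\<close>

lemma B_rows:
  assumes "\<gamma> < N y x h" "\<mu> < N y x h"
  shows "(\<Sum>\<kappa><N (st y) h x. B y x h \<mu> \<kappa> * cnj (B y x h \<gamma> \<kappa>)) =
    of_real (d h / (d x * d y)) * of_bool (\<gamma> = \<mu>)"
proof -
  let ?S = "\<lambda>\<mu> \<gamma>. \<Sum>\<kappa><N (st y) h x. B y x h \<mu> \<kappa> * cnj (B y x h \<gamma> \<kappa>)"
  define s where "s = piv C h * piv C (st x) * piv C (st y)"
  have \<phi>S: "\<phi> h * s * ?S \<mu> \<gamma> = \<phi> x * \<phi> y * of_bool (\<gamma> = \<mu>)" if "\<gamma> < N y x h" "\<mu> < N y x h" for \<gamma> \<mu>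
  proof -
    have "\<phi> h * s * ?S \<mu> \<gamma> = (\<Sum>\<kappa><N (st y) h x. cnj (B y x h \<gamma> \<kappa>) * (\<phi> h * s * B y x h \<mu> \<kappa>))"
      by (simp add: sum_distrib_left mult_ac)
    also have "\<dots> = (\<Sum>\<kappa><N (st y) h x. cnj (B y x h \<gamma> \<kappa>) * (\<phi> x * B (st y) h x \<kappa> \<mu>))"
      using that by (intro sum.cong refl) (simp add: s_def B_transpose)
    also have "\<dots> = \<phi> x * (\<Sum>\<kappa><N (st y) h x. cnj (B y x h \<gamma> \<kappa>) * B (st y) h x \<kappa> \<mu>)"
      by (simp add: sum_distrib_left mult_ac)
    finally show ?thesis using that by (simp add: B_bend_back)
  qed
  define t where "t = piv C x * piv C y * piv C h * s"
  have ss: "s * s = 1" "piv C h * piv C h = 1" and t: "t = 1 \<or> t = - 1"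
    using piv_cases[of h] piv_cases[of "st x"] piv_cases[of "st y"] piv_cases[of x] piv_cases[of y]
    unfolding s_def t_def by auto
  have S: "?S \<mu> \<gamma> = t * of_real (d h / (d x * d y)) * of_bool (\<gamma> = \<mu>)" if "\<gamma> < N y x h" "\<mu> < N y x h" for \<gamma> \<mu>
  proof -
    have "?S \<mu> \<gamma> = (s * s) * (piv C h * piv C h) * ?S \<mu> \<gamma>" using ss by simp
    also have "\<dots> = s * piv C h * of_real (d h) * (\<phi> h * s * ?S \<mu> \<gamma>)"
      by (simp add: \<phi>_eq mult_ac)
    also have "\<dots> = t * of_real (d h / (d x * d y)) * of_bool (\<gamma> = \<mu>)"
      unfolding \<phi>S[OF that]
      by (simp add: \<phi>_eq t_def mult_ac)
    finally show ?thesis .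
  qed
  have "t = 1"
  proof (rule ccontr)
    assume "t \<noteq> 1"
    then have "?S \<mu> \<mu> = - of_real (d h / (d x * d y))" using S[OF assms(2,2)] t by simp
    moreover have "?S \<mu> \<mu> = of_real (\<Sum>\<kappa><N (st y) h x. (cmod (B y x h \<mu> \<kappa>))\<^sup>2)"
      by (simp only: of_real_sum complex_norm_square)
    ultimately have "(\<Sum>\<kappa><N (st y) h x. (cmod (B y x h \<mu> \<kappa>))\<^sup>2) = - (d h / (d x * d y))"
      by (metis of_real_eq_iff of_real_minus)
    moreover have "(\<Sum>\<kappa><N (st y) h x. (cmod (B y x h \<mu> \<kappa>))\<^sup>2) \<ge> 0" by (intro sum_nonneg) auto
    moreover have "d h / (d x * d y) > 0" by simp
    ultimately show False by linarith
  qed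
  then show ?thesis using S[OF assms] by simp
qed

end

lemma sum_rotate3:
  "(\<Sum>i\<in>A. \<Sum>j\<in>J. \<Sum>k\<in>K j. f i j k) = (\<Sum>j\<in>J. \<Sum>k\<in>K j. \<Sum>i\<in>A. f i j k)"
  by (subst sum.swap) (rule sum.cong[OF refl], rule sum.swap)

section \<open>Orthogonality of \<open>F\<close> across total charges, and dimensions as a character
  of the fusion ring\<close>

context unitary_F_mtc
begin

text \<open>Unitarity of each \<open>F y x z k\<close> says nothing about sums over the total charge
  \<open>k\<close>. Bending \<open>y\<close> turns these entries into entries of the single matrix
  \<open>F (st y) h z f\<close>, where \<open>k\<close> is a column label, so ordinary row
  orthogonality applies. \<open>B_rows\<close> is used twice: the bend at \<open>k\<close> produces
  the weight \<open>d k\<close>, the bend at \<open>h\<close> the constant on the right.\<close>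

lemma F_trace_orthogonality:
  assumes "\<eta> < N y x h" "\<eta>' < N y x h" "\<gamma> < N x z f" "\<gamma>' < N x z f"
  shows "(\<Sum>k\<in>UNIV. of_real (d k) * (\<Sum>\<rho><N h z k. \<Sum>\<kappa><N y f k.
      cnj (F y x z k (h, \<eta>, \<rho>) (f, \<gamma>, \<kappa>)) * F y x z k (h, \<eta>', \<rho>) (f, \<gamma>', \<kappa>))) =
    of_real (d h * d f / d x) * (of_bool (\<eta> = \<eta>') * of_bool (\<gamma> = \<gamma>'))"
proof -
  let ?B = "B y x h"
  let ?F = "\<lambda>k \<eta> \<rho> \<gamma> \<kappa>. F y x z k (h, \<eta>, \<rho>) (f, \<gamma>, \<kappa>)"
  let ?G = "\<lambda>\<psi> \<gamma> k \<rho> \<mu>. F (st y) h z f (x, \<psi>, \<gamma>) (k, \<rho>, \<mu>)"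
  let ?L = "\<lambda>\<eta> \<gamma> k \<rho> \<mu>. \<Sum>\<psi><N (st y) h x. ?B \<eta> \<psi> * ?G \<psi> \<gamma> k \<rho> \<mu>"
  have inner: "(\<Sum>\<mu><N (st y) k f. ?L \<eta> \<gamma> k \<rho> \<mu> * cnj (?L \<eta>' \<gamma>' k \<rho> \<mu>)) =
      of_real (d k / (d f * d y)) * (\<Sum>\<kappa><N y f k. cnj (?F k \<eta> \<rho> \<gamma> \<kappa>) * ?F k \<eta>' \<rho> \<gamma>' \<kappa>)"
    if "\<rho> < N h z k" for k \<rho>
  proof -
    have "(\<Sum>\<mu><N (st y) k f. ?L \<eta> \<gamma> k \<rho> \<mu> * cnj (?L \<eta>' \<gamma>' k \<rho> \<mu>)) =
       (\<Sum>\<mu><N (st y) k f. (\<Sum>\<kappa><N y f k. B y f k \<kappa> \<mu> * cnj (?F k \<eta> \<rho> \<gamma> \<kappa>)) *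
          cnj (\<Sum>\<kappa><N y f k. B y f k \<kappa> \<mu> * cnj (?F k \<eta>' \<rho> \<gamma>' \<kappa>)))"
      using assms that by (intro sum.cong refl) (simp add: bend_move)
    also have "\<dots> = (\<Sum>\<mu><N (st y) k f. \<Sum>\<kappa><N y f k. \<Sum>\<kappa>'<N y f k.
        (cnj (?F k \<eta> \<rho> \<gamma> \<kappa>) * ?F k \<eta>' \<rho> \<gamma>' \<kappa>') * (B y f k \<kappa> \<mu> * cnj (B y f k \<kappa>' \<mu>)))"
      by (simp add: sum_product mult_ac)
    also have "\<dots> = (\<Sum>\<kappa><N y f k. \<Sum>\<kappa>'<N y f k. \<Sum>\<mu><N (st y) k f.
        (cnj (?F k \<eta> \<rho> \<gamma> \<kappa>) * ?F k \<eta>' \<rho> \<gamma>' \<kappa>') * (B y f k \<kappa> \<mu> * cnj (B y f k \<kappa>' \<mu>)))"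
      by (rule sum_rotate3)
    also have "\<dots> = (\<Sum>\<kappa><N y f k. \<Sum>\<kappa>'<N y f k.
        (cnj (?F k \<eta> \<rho> \<gamma> \<kappa>) * ?F k \<eta>' \<rho> \<gamma>' \<kappa>' * of_real (d k / (d f * d y))) * of_bool (\<kappa>' = \<kappa>))"
      unfolding sum_distrib_left[symmetric] by (intro sum.cong refl) (simp add: B_rows)
    also have "\<dots> = (\<Sum>\<kappa><N y f k. cnj (?F k \<eta> \<rho> \<gamma> \<kappa>) * ?F k \<eta>' \<rho> \<gamma>' \<kappa> * of_real (d k / (d f * d y)))"
      by (intro sum.cong refl sum_mult_of_bool_single) auto
    finally show ?thesis by (simp only: sum_distrib_left mult.commute)
  qed
  have "of_real (1 / (d f * d y)) * (\<Sum>k\<in>UNIV. of_real (d k) * (\<Sum>\<rho><N h z k. \<Sum>\<kappa><N y f k. cnj (?F k \<eta> \<rho> \<gamma> \<kappa>) * ?F k \<eta>' \<rho> \<gamma>' \<kappa>)) =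
    (\<Sum>k\<in>UNIV. \<Sum>\<rho><N h z k. of_real (d k / (d f * d y)) * (\<Sum>\<kappa><N y f k. cnj (?F k \<eta> \<rho> \<gamma> \<kappa>) * ?F k \<eta>' \<rho> \<gamma>' \<kappa>))"
    by (simp add: sum_distrib_left)
  also have "\<dots> = (\<Sum>k\<in>UNIV. \<Sum>\<rho><N h z k. \<Sum>\<mu><N (st y) k f. ?L \<eta> \<gamma> k \<rho> \<mu> * cnj (?L \<eta>' \<gamma>' k \<rho> \<mu>))"
    by (intro sum.cong refl inner[symmetric]) auto
  also have "\<dots> = (\<Sum>j\<in>F_cols C (st y) h z f. (\<Sum>\<psi><N (st y) h x. ?B \<eta> \<psi> * F (st y) h z f (x, \<psi>, \<gamma>) j) *
      cnj (\<Sum>\<psi>'<N (st y) h x. ?B \<eta>' \<psi>' * F (st y) h z f (x, \<psi>', \<gamma>') j))"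
    by (simp add: sum_F_cols)
  also have "\<dots> = (\<Sum>j\<in>F_cols C (st y) h z f. \<Sum>\<psi><N (st y) h x. \<Sum>\<psi>'<N (st y) h x. (?B \<eta> \<psi> * cnj (?B \<eta>' \<psi>')) *
      (F (st y) h z f (x, \<psi>, \<gamma>) j * cnj (F (st y) h z f (x, \<psi>', \<gamma>') j)))"
    by (simp add: sum_product mult_ac)
  also have "\<dots> = (\<Sum>\<psi><N (st y) h x. \<Sum>\<psi>'<N (st y) h x. \<Sum>j\<in>F_cols C (st y) h z f. (?B \<eta> \<psi> * cnj (?B \<eta>' \<psi>')) *
      (F (st y) h z f (x, \<psi>, \<gamma>) j * cnj (F (st y) h z f (x, \<psi>', \<gamma>') j)))"
    by (rule sum_rotate3)
  also have "\<dots> = (\<Sum>\<psi><N (st y) h x. \<Sum>\<psi>'<N (st y) h x. (?B \<eta> \<psi> * cnj (?B \<eta>' \<psi>') * of_bool (\<gamma> = \<gamma>')) * of_bool (\<psi> = \<psi>'))"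
    unfolding sum_distrib_left[symmetric] using assms
    by (intro sum.cong refl) (auto simp: unitary_rows[OF F_uni])
  also have "\<dots> = (\<Sum>\<psi><N (st y) h x. ?B \<eta> \<psi> * cnj (?B \<eta>' \<psi>) * of_bool (\<gamma> = \<gamma>'))"
    by (intro sum.cong refl sum_mult_of_bool_single) auto
  also have "\<dots> = of_real (d h / (d x * d y)) * (of_bool (\<eta> = \<eta>') * of_bool (\<gamma> = \<gamma>'))"
    unfolding sum_distrib_right[symmetric] using assms by (simp add: B_rows)
  finally have "of_real (d f * d y) * (of_real (1 / (d f * d y)) * (\<Sum>k\<in>UNIV. of_real (d k) * (\<Sum>\<rho><N h z k. \<Sum>\<kappa><N y f k. cnj (?F k \<eta> \<rho> \<gamma> \<kappa>) * ?F k \<eta>' \<rho> \<gamma>' \<kappa>))) =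
    of_real (d f * d y) * (complex_of_real (d h / (d x * d y)) * (of_bool (\<eta> = \<eta>') * of_bool (\<gamma> = \<gamma>')))"
    by (rule arg_cong)
  then show ?thesis by (simp add: mult_ac)
qed

text \<open>The vacuum row of \<open>F (st y) y x x\<close> is a unit vector, and
  \<open>B_rows\<close> tells how much of its squared length lies in each channel
  \<open>h\<close>.\<close>

lemma d_mult: "d y * d x = (\<Sum>h\<in>UNIV. real (N y x h) * d h)"
proof -
  have "1 = (\<Sum>j\<in>F_cols C (st y) y x x. F (st y) y x x (v, 0, 0) j * cnj (F (st y) y x x (v, 0, 0) j))"
    by (subst unitary_rows[OF F_uni]) auto
  also have "\<dots> = (\<Sum>h\<in>UNIV. \<Sum>\<eta><N y x h. \<Sum>\<psi><N (st y) h x. B y x h \<eta> \<psi> * cnj (B y x h \<eta> \<psi>))"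
    by (simp add: sum_F_cols B_def)
  also have "\<dots> = (\<Sum>h\<in>UNIV. \<Sum>\<eta><N y x h. of_real (d h / (d x * d y)))"
    by (intro sum.cong refl) (simp add: B_rows)
  also have "\<dots> = of_real ((\<Sum>h\<in>UNIV. real (N y x h) * d h) / (d y * d x))"
    by (simp add: sum_divide_distrib mult_ac)
  finally have "(\<Sum>h\<in>UNIV. real (N y x h) * d h) / (d y * d x) = 1"
    by (metis of_real_eq_1_iff)
  then show ?thesis by simp
qed

lemma d_dual: "d (st a) = d a"
  using mtc unfolding modular_tensor_category_def spherical_def d_def by simp

text \<open>Frobenius reciprocity, from traces: taking the trace in \<open>B_bend_back\<close> for
  \<open>y\<close> and for \<open>st y\<close> gives complex conjugate numbers. Both zigzag scalars
  have modulus \<open>1 / d b\<close>, since dual dimensions agree, so the multiplicities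
  agree.\<close>

lemma N_dual: "N b c f = N (st b) f c"
proof -
  have tr: "\<phi> y * of_nat (N y x h) = (\<Sum>\<gamma><N y x h. \<Sum>\<kappa><N (st y) h x. cnj (B y x h \<gamma> \<kappa>) * B (st y) h x \<kappa> \<gamma>)" for y x h
    by (simp add: B_bend_back mult.commute)
  have "\<phi> (st b) * of_nat (N (st b) f c) = cnj (\<phi> b * of_nat (N b c f))"
    unfolding tr by (subst sum.swap) (simp add: mult.commute)
  then have "cmod (\<phi> (st b)) * real (N (st b) f c) = cmod (\<phi> b) * real (N b c f)"
    by (metis complex_mod_cnj norm_mult norm_of_nat)
  moreover have "cmod (\<phi> a) = 1 / d a" for a
    using piv_cases[of a] less_imp_le[OF d_pos[of a]] by (auto simp: \<phi>_eq norm_divide)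
  ultimately show ?thesis by (simp add: d_dual)
qed

text \<open>The values \<open>t c\<close> form an eigenvector of the fusion matrix of
  \<open>b\<close> with eigenvalue \<open>t b\<close>; by \<open>N_dual\<close> the dimensions form
  one of its transpose with eigenvalue \<open>d (st b)\<close>. Two positive vectors have nonzero
  pairing, so the eigenvalues agree. Applying this also to \<open>d\<close> itself removes the
  dual.\<close>

lemma positive_character_unique:
  fixes t :: "'a \<Rightarrow> real"
  assumes pos: "\<And>b. 0 < t b" and mult: "\<And>b c. t b * t c = (\<Sum>f\<in>UNIV. real (N b c f) * t f)"
  shows "t b = d b"
proof -
  have dual: "t b = d (st b)"
    if pos: "\<And>b. 0 < t b" and mult: "\<And>b c. t b * t c = (\<Sum>f\<in>UNIV. real (N b c f) * t f)" for t :: "'a \<Rightarrow> real" and b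
  proof -
    let ?s = "\<Sum>c\<in>UNIV. t c * d c"
    have "t b * ?s = (\<Sum>c\<in>UNIV. \<Sum>f\<in>UNIV. real (N b c f) * t f * d c)"
      by (simp add: sum_distrib_left sum_distrib_right mult.assoc[symmetric] mult)
    also have "\<dots> = (\<Sum>f\<in>UNIV. t f * (\<Sum>c\<in>UNIV. real (N (st b) f c) * d c))"
      by (subst sum.swap) (simp add: sum_distrib_left mult_ac N_dual[of b])
    also have "\<dots> = d (st b) * ?s"
      by (simp only: d_mult[symmetric]) (simp add: sum_distrib_left mult_ac)
    finally have "t b * ?s = d (st b) * ?s" .
    moreover have "?s > 0" by (intro sum_pos) (auto simp: pos)
    ultimately show ?thesis by simp
  qed
  show ?thesis using dual[of t b, OF pos mult] dual[of d b, OF d_pos d_mult] by simp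
qed

section \<open>The squared norm of a braiding, and unitarity of \<open>R\<close>\<close>

text \<open>The partial trace over \<open>b\<close> of \<open>R\<^sup>* R\<close> on \<open>a \<otimes> b\<close> is a scalar because \<open>a\<close> is simple. It is a
  character of the fusion ring in \<open>b\<close> since the hexagon makes the braiding with \<open>b \<otimes> c\<close> a product.\<close>

lemma hexagon_character:
  assumes hex: "hexagon C R"
  defines "r \<equiv> \<lambda>a b. \<Sum>e\<in>UNIV. d e * (\<Sum>\<alpha><N a b e. \<Sum>\<alpha>'<N b a e. (cmod (R a b e \<alpha> \<alpha>'))\<^sup>2)"
  shows "(\<Sum>f\<in>UNIV. real (N b c f) * r a f) = r a b * r a c / d a"
proof -
  \<comment> \<open>\<open>H z\<close> is the right side of the hexagon as a matrix, the braiding of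
    \<open>a\<close> past \<open>b\<close> and then \<open>c\<close> at total charge
    \<open>z\<close>. Its squared norm, weighted by \<open>d z\<close>, is computed from both sides
    of the hexagon.\<close>
  define H where "H = (\<lambda>z i j. case i of (e, \<alpha>, \<beta>) \<Rightarrow> case j of (g, \<sigma>, \<tau>) \<Rightarrow>
    \<Sum>\<alpha>'<N b a e. \<Sum>\<sigma>'<N a c g. R a b e \<alpha> \<alpha>' * F b a c z (e, \<alpha>', \<beta>) (g, \<sigma>', \<tau>) * R a c g \<sigma>' \<sigma>)"
  define Y where "Y = (\<lambda>z (f, \<mu>, \<nu>) j. \<Sum>\<rho><N f a z. R a f z \<nu> \<rho> * F b c a z (f, \<mu>, \<rho>) j)"
  have H_Y: "H z i j = (\<Sum>k\<in>F_cols C a b c z. F a b c z i k * Y z k j)"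
    if ij: "i \<in> F_rows C a b c z" "j \<in> F_cols C b c a z" for z i j
  proof -
    obtain e \<alpha> \<beta> g \<sigma> \<tau> where eq: "i = (e, \<alpha>, \<beta>)" "j = (g, \<sigma>, \<tau>)" by (metis surj_pair)
    have "(\<Sum>f\<in>UNIV. \<Sum>\<mu><N b c f. \<Sum>\<nu><N a f z. \<Sum>\<rho><N f a z.
            F a b c z (e, \<alpha>, \<beta>) (f, \<mu>, \<nu>) * R a f z \<nu> \<rho> * F b c a z (f, \<mu>, \<rho>) (g, \<sigma>, \<tau>)) = H z i j"
      using hex ij unfolding hexagon_def H_def eq by simp
    then show ?thesis by (simp add: sum_F_cols Y_def eq sum_distrib_left mult.assoc)
  qed
  have norm_Y: "(\<Sum>j\<in>F_cols C b c a z. (cmod (Y z (f, \<mu>, \<nu>) j))\<^sup>2) = (\<Sum>\<rho><N f a z. (cmod (R a f z \<nu> \<rho>))\<^sup>2)"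
    if "\<mu> < N b c f" for z f \<mu> \<nu>
  proof -
    let ?x = "\<lambda>(f', \<mu>', \<rho>). of_bool (f' = f \<and> \<mu>' = \<mu>) * R a f z \<nu> \<rho>"
    have "Y z (f, \<mu>, \<nu>) j = (\<Sum>i\<in>F_rows C b c a z. ?x i * F b c a z i j)" for j
      unfolding sum_F_rows Y_def
      by (subst sum_single[where k = f], simp, simp, simp, subst sum_single[where k = \<mu>]) (use that in auto)
    then have "(\<Sum>j\<in>F_cols C b c a z. (cmod (Y z (f, \<mu>, \<nu>) j))\<^sup>2) = (\<Sum>i\<in>F_rows C b c a z. (cmod (?x i))\<^sup>2)"
      by (simp only: unitary_norm_right[OF F_uni finite_F_rows])
    also have "\<dots> = (\<Sum>\<rho><N f a z. (cmod (R a f z \<nu> \<rho>))\<^sup>2)"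
      unfolding sum_F_rows
      by (subst sum_single[where k = f], simp, simp, simp, subst sum_single[where k = \<mu>]) (use that in auto)
    finally show ?thesis .
  qed
  \<comment> \<open>The two \<open>F\<close> factors are unitary and do not affect the norm. What
    remains is the braiding with \<open>f\<close>, once for each of the \<open>N b c f\<close>
    values of \<open>\<mu>\<close>.\<close>
  have left: "(\<Sum>i\<in>F_rows C a b c z. \<Sum>j\<in>F_cols C b c a z. (cmod (H z i j))\<^sup>2) =
      (\<Sum>f\<in>UNIV. real (N b c f) * (\<Sum>\<nu><N a f z. \<Sum>\<rho><N f a z. (cmod (R a f z \<nu> \<rho>))\<^sup>2))" for z
  proof -
    have "(\<Sum>i\<in>F_rows C a b c z. \<Sum>j\<in>F_cols C b c a z. (cmod (H z i j))\<^sup>2) =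
      (\<Sum>j\<in>F_cols C b c a z. \<Sum>i\<in>F_rows C a b c z. (cmod (\<Sum>k\<in>F_cols C a b c z. F a b c z i k * Y z k j))\<^sup>2)"
      by (subst sum.swap) (intro sum.cong refl, simp add: H_Y)
    also have "\<dots> = (\<Sum>j\<in>F_cols C b c a z. \<Sum>k\<in>F_cols C a b c z. (cmod (Y z k j))\<^sup>2)"
      by (simp only: unitary_norm_left[OF F_uni finite_F_cols])
    also have "\<dots> = (\<Sum>f\<in>UNIV. \<Sum>\<mu><N b c f. \<Sum>\<nu><N a f z. \<Sum>j\<in>F_cols C b c a z. (cmod (Y z (f, \<mu>, \<nu>) j))\<^sup>2)"
      by (subst sum.swap) (simp only: sum_F_cols)
    also have "\<dots> = (\<Sum>f\<in>UNIV. real (N b c f) * (\<Sum>\<nu><N a f z. \<Sum>\<rho><N f a z. (cmod (R a f z \<nu> \<rho>))\<^sup>2))"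
      by (simp add: norm_Y)
    finally show ?thesis .
  qed
  let ?W = "\<lambda>e \<alpha> g \<sigma>. \<Sum>\<alpha>'<N b a e. \<Sum>\<sigma>'<N a c g. (cmod (R a b e \<alpha> \<alpha>'))\<^sup>2 * (cmod (R a c g \<sigma>' \<sigma>))\<^sup>2"
  \<comment> \<open>Here \<open>F\<close> sits between the two braidings, and only after weighting
    by \<open>d z\<close> and summing over \<open>z\<close> does
    \<open>F_trace_orthogonality\<close> make the double sum over pairs diagonal, so that the norms
    of the braidings factor.\<close>
  have right: "(\<Sum>z\<in>UNIV. of_real (d z) * (\<Sum>\<beta><N e c z. \<Sum>\<tau><N b g z. H z (e, \<alpha>, \<beta>) (g, \<sigma>, \<tau>) * cnj (H z (e, \<alpha>, \<beta>) (g, \<sigma>, \<tau>)))) =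
     complex_of_real (d e * d g / d a * ?W e \<alpha> g \<sigma>)" for e \<alpha> g \<sigma>
  proof -
    let ?I = "{..<N b a e} \<times> {..<N a c g}"
    let ?u = "\<lambda>p. R a b e \<alpha> (fst p) * R a c g (snd p) \<sigma>"
    let ?f = "\<lambda>z \<beta> \<tau> p. F b a c z (e, fst p, \<beta>) (g, snd p, \<tau>)"
    have H: "H z (e, \<alpha>, \<beta>) (g, \<sigma>, \<tau>) = (\<Sum>p\<in>?I. ?u p * ?f z \<beta> \<tau> p)" for z \<beta> \<tau>
      by (simp add: H_def sum.cartesian_product split_def mult_ac)
    have "(\<Sum>z\<in>UNIV. of_real (d z) * (\<Sum>\<beta><N e c z. \<Sum>\<tau><N b g z. H z (e, \<alpha>, \<beta>) (g, \<sigma>, \<tau>) * cnj (H z (e, \<alpha>, \<beta>) (g, \<sigma>, \<tau>)))) =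
      (\<Sum>z\<in>UNIV. \<Sum>\<beta><N e c z. \<Sum>\<tau><N b g z. \<Sum>p\<in>?I. \<Sum>q\<in>?I.
        (cnj (?u p) * ?u q) * (of_real (d z) * (cnj (?f z \<beta> \<tau> p) * ?f z \<beta> \<tau> q)))"
      unfolding H by (subst mult.commute[of "sum _ ?I" "cnj _"]) (simp add: sum_product sum_distrib_left mult_ac)
    also have "\<dots> = (\<Sum>p\<in>?I. \<Sum>q\<in>?I. \<Sum>z\<in>UNIV. \<Sum>\<beta><N e c z. \<Sum>\<tau><N b g z.
        (cnj (?u p) * ?u q) * (of_real (d z) * (cnj (?f z \<beta> \<tau> p) * ?f z \<beta> \<tau> q)))"
      by (rule trans[OF sum.cong[OF refl trans[OF sum.cong[OF refl sum_rotate3] sum_rotate3]] sum_rotate3])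
    also have "\<dots> = (\<Sum>p\<in>?I. \<Sum>q\<in>?I. (cnj (?u p) * ?u q) *
        (\<Sum>z\<in>UNIV. of_real (d z) * (\<Sum>\<beta><N e c z. \<Sum>\<tau><N b g z. cnj (?f z \<beta> \<tau> p) * ?f z \<beta> \<tau> q)))"
      by (simp add: sum_distrib_left)
    also have "\<dots> = (\<Sum>p\<in>?I. \<Sum>q\<in>?I. (cnj (?u p) * ?u q * of_real (d e * d g / d a)) * of_bool (p = q))"
      by (intro sum.cong refl) (auto simp: F_trace_orthogonality prod_eq_iff)
    also have "\<dots> = (\<Sum>p\<in>?I. cnj (?u p) * ?u p * of_real (d e * d g / d a))"
      by (intro sum.cong refl sum_mult_of_bool_single) auto
    also have "\<dots> = (\<Sum>p\<in>?I. of_real (d e * d g / d a * ((cmod (R a b e \<alpha> (fst p)))\<^sup>2 * (cmod (R a c g (snd p) \<sigma>))\<^sup>2)))"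
      by (intro sum.cong refl) (simp only: of_real_mult complex_norm_square complex_cnj_mult mult_ac)
    also have "\<dots> = of_real (d e * d g / d a * ?W e \<alpha> g \<sigma>)"
      by (simp only: of_real_sum[symmetric] sum_distrib_left sum.cartesian_product split_def)
    finally show ?thesis .
  qed
  have rightr: "(\<Sum>z\<in>UNIV. d z * (\<Sum>\<beta><N e c z. \<Sum>\<tau><N b g z. (cmod (H z (e, \<alpha>, \<beta>) (g, \<sigma>, \<tau>)))\<^sup>2)) =
     d e * d g / d a * ?W e \<alpha> g \<sigma>" for e \<alpha> g \<sigma>
    using right[of e \<alpha> g \<sigma>] unfolding complex_norm_square[symmetric] of_real_sum[symmetric] of_real_mult[symmetric] of_real_eq_iff .
  have "(\<Sum>f\<in>UNIV. real (N b c f) * r a f) =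
      (\<Sum>z\<in>UNIV. d z * (\<Sum>f\<in>UNIV. real (N b c f) * (\<Sum>\<nu><N a f z. \<Sum>\<rho><N f a z. (cmod (R a f z \<nu> \<rho>))\<^sup>2)))"
    unfolding r_def sum_distrib_left by (subst sum.swap) (simp add: mult_ac)
  also have "\<dots> = (\<Sum>z\<in>UNIV. d z * (\<Sum>i\<in>F_rows C a b c z. \<Sum>j\<in>F_cols C b c a z. (cmod (H z i j))\<^sup>2))"
    unfolding left ..
  also have "\<dots> = (\<Sum>z\<in>UNIV. d z * (\<Sum>e\<in>UNIV. \<Sum>\<alpha><N a b e. \<Sum>\<beta><N e c z. \<Sum>g\<in>UNIV. \<Sum>\<sigma><N c a g. \<Sum>\<tau><N b g z.
      (cmod (H z (e, \<alpha>, \<beta>) (g, \<sigma>, \<tau>)))\<^sup>2))"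
    unfolding sum_F_rows sum_F_cols ..
  also have "\<dots> = (\<Sum>z\<in>UNIV. \<Sum>e\<in>UNIV. \<Sum>\<alpha><N a b e. \<Sum>g\<in>UNIV. \<Sum>\<sigma><N c a g. d z * (\<Sum>\<beta><N e c z. \<Sum>\<tau><N b g z.
      (cmod (H z (e, \<alpha>, \<beta>) (g, \<sigma>, \<tau>)))\<^sup>2))"
    unfolding sum_distrib_left by (rule sum.cong[OF refl sum.cong[OF refl sum.cong[OF refl sum_rotate3]]])
  also have "\<dots> = (\<Sum>e\<in>UNIV. \<Sum>\<alpha><N a b e. \<Sum>g\<in>UNIV. \<Sum>\<sigma><N c a g. \<Sum>z\<in>UNIV. d z * (\<Sum>\<beta><N e c z. \<Sum>\<tau><N b g z.
      (cmod (H z (e, \<alpha>, \<beta>) (g, \<sigma>, \<tau>)))\<^sup>2))"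
    by (rule trans[OF sum_rotate3 sum.cong[OF refl sum.cong[OF refl sum_rotate3]]])
  also have "\<dots> = (\<Sum>e\<in>UNIV. \<Sum>\<alpha><N a b e. \<Sum>g\<in>UNIV. \<Sum>\<sigma><N c a g. d e * d g / d a * ?W e \<alpha> g \<sigma>)"
    unfolding rightr ..
  also have "\<dots> = (\<Sum>e\<in>UNIV. \<Sum>\<alpha><N a b e. \<Sum>g\<in>UNIV. \<Sum>\<sigma><N c a g.
      (d e * (\<Sum>\<alpha>'<N b a e. (cmod (R a b e \<alpha> \<alpha>'))\<^sup>2)) * (d g * (\<Sum>\<sigma>'<N a c g. (cmod (R a c g \<sigma>' \<sigma>))\<^sup>2)) / d a)"
    by (intro sum.cong refl) (simp add: sum_product[symmetric] mult_ac)
  also have "\<dots> = (\<Sum>e\<in>UNIV. \<Sum>\<alpha><N a b e. d e * (\<Sum>\<alpha>'<N b a e. (cmod (R a b e \<alpha> \<alpha>'))\<^sup>2)) *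
      (\<Sum>g\<in>UNIV. \<Sum>\<sigma><N c a g. d g * (\<Sum>\<sigma>'<N a c g. (cmod (R a c g \<sigma>' \<sigma>))\<^sup>2)) / d a"
    by (simp only: sum_distrib_left[symmetric] sum_distrib_right[symmetric] sum_divide_distrib[symmetric])
  also have "(\<Sum>e\<in>UNIV. \<Sum>\<alpha><N a b e. d e * (\<Sum>\<alpha>'<N b a e. (cmod (R a b e \<alpha> \<alpha>'))\<^sup>2)) = r a b"
    by (simp add: r_def sum_distrib_left)
  also have "(\<Sum>g\<in>UNIV. \<Sum>\<sigma><N c a g. d g * (\<Sum>\<sigma>'<N a c g. (cmod (R a c g \<sigma>' \<sigma>))\<^sup>2)) = r a c"
    unfolding r_def sum_distrib_left by (subst sum.swap[of _ "{..<N c a _}"]) (rule refl)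
  finally show ?thesis .
qed

text \<open>For fixed \<open>a\<close>, dividing the left side by \<open>d a\<close> turns
  \<open>hexagon_character\<close> into exact multiplicativity in \<open>b\<close>, so
  \<open>positive_character_unique\<close> identifies the quotient with \<open>d b\<close>. It is
  positive because \<open>R\<close> is invertible and, by \<open>d_mult\<close>, some channel of
  \<open>a\<close> and \<open>b\<close> is nonempty.\<close>

lemma hexagon_norm:
  assumes hex: "hexagon C R"
    and inv: "\<And>a b c. \<exists>Q. inverse_matrices_on {..<N a b c} {..<N b a c} (R a b c) Q"
  shows "(\<Sum>e\<in>UNIV. d e * (\<Sum>\<alpha><N a b e. \<Sum>\<alpha>'<N b a e. (cmod (R a b e \<alpha> \<alpha>'))\<^sup>2)) = d a * d b"
proof -
  define r where "r = (\<lambda>a b. \<Sum>e\<in>UNIV. d e * (\<Sum>\<alpha><N a b e. \<Sum>\<alpha>'<N b a e. (cmod (R a b e \<alpha> \<alpha>'))\<^sup>2))"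
  have nonneg: "0 \<le> r a b" for b unfolding r_def by (intro sum_nonneg mult_nonneg_nonneg less_imp_le[OF d_pos] zero_le_power2)
  have mult: "(\<Sum>f\<in>UNIV. real (N b c f) * r a f) = r a b * r a c / d a" for b c
    unfolding r_def by (rule hexagon_character[OF hex])
  have "r a b \<noteq> 0" for b
  proof
    assume r0: "r a b = 0"
    have "R a b e \<alpha> \<alpha>' = 0" if "\<alpha> < N a b e" "\<alpha>' < N b a e" for e \<alpha> \<alpha>'
    proof -
      have "d e * (\<Sum>\<alpha><N a b e. \<Sum>\<alpha>'<N b a e. (cmod (R a b e \<alpha> \<alpha>'))\<^sup>2) = 0"
        using r0 unfolding r_def
        by (subst (asm) sum_nonneg_eq_0_iff) (auto intro!: sum_nonneg mult_nonneg_nonneg less_imp_le[OF d_pos])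
      then have "(\<Sum>\<alpha><N a b e. \<Sum>\<alpha>'<N b a e. (cmod (R a b e \<alpha> \<alpha>'))\<^sup>2) = 0" by simp
      then show ?thesis using that by (simp add: sum_nonneg_eq_0_iff sum_nonneg)
    qed
    moreover have "\<exists>e. N a b e \<noteq> 0"
    proof (rule ccontr)
      assume "\<nexists>e. N a b e \<noteq> 0"
      then have "d a * d b = 0" using d_mult[of a b] by simp
      then show False by simp
    qed
    then obtain e where "0 < N a b e" by auto
    moreover obtain Q where "inverse_matrices_on {..<N a b e} {..<N b a e} (R a b e) Q" using inv by blast
    ultimately show False unfolding inverse_matrices_on_def by fastforce
  qed
  then have pos: "0 < r a b / d a" for b using nonneg[of b] by (intro divide_pos_pos d_pos) (simp add: less_le)
  have "r a b / d a = d b"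
    by (rule positive_character_unique[of "\<lambda>b. r a b / d a", OF pos])
      (simp add: mult[symmetric] sum_divide_distrib[symmetric])
  then have "r a b = d a * d b" by (simp add: field_simps)
  then show ?thesis by (simp add: r_def)
qed

theorem R_unitary: "R_unitary C"
proof -
  let ?R = "Rsym C"
  obtain R' where hex: "hexagon C ?R" "hexagon C R'"
    and inv: "\<And>a b c. inverse_matrices_on {..<N a b c} {..<N b a c} (?R a b c) (R' b a c)"
    using mtc unfolding modular_tensor_category_def braided_def by blast
  have inv': "inverse_matrices_on {..<N a b c} {..<N b a c} (R' a b c) (?R b a c)" for a b c
    using inv[of b a c] unfolding inverse_matrices_on_def by blast
  have "R' b a c \<nu> \<mu> = cnj (?R a b c \<mu> \<nu>)" if "\<mu> < N a b c" "\<nu> < N b a c" for a b c \<mu> \<nu>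
  proof -
    \<comment> \<open>\<open>?D c\<close> is the squared Hilbert-Schmidt distance in channel
      \<open>c\<close> between the inverse braiding and the adjoint of the braiding. Its cross term
      is the trace of an identity matrix, so after weighting by \<open>d c\<close> the two norms
      from \<open>hexagon_norm\<close> cancel against twice \<open>d_mult\<close>.\<close>
    let ?D = "\<lambda>c. \<Sum>\<mu><N a b c. \<Sum>\<nu><N b a c. (cmod (R' b a c \<nu> \<mu> - cnj (?R a b c \<mu> \<nu>)))\<^sup>2"
    have D: "?D c = (\<Sum>\<mu><N a b c. \<Sum>\<nu><N b a c. (cmod (?R a b c \<mu> \<nu>))\<^sup>2) +
        (\<Sum>\<nu><N b a c. \<Sum>\<mu><N a b c. (cmod (R' b a c \<nu> \<mu>))\<^sup>2) - 2 * real (N a b c)" for c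
    proof -
      have "(cmod (x - cnj y))\<^sup>2 = (cmod y)\<^sup>2 + (cmod x)\<^sup>2 - 2 * Re (y * x)" for x y
        unfolding cmod_power2 by (simp add: power2_eq_square algebra_simps)
      then have "?D c = (\<Sum>\<mu><N a b c. \<Sum>\<nu><N b a c. (cmod (?R a b c \<mu> \<nu>))\<^sup>2) +
        (\<Sum>\<mu><N a b c. \<Sum>\<nu><N b a c. (cmod (R' b a c \<nu> \<mu>))\<^sup>2) - 2 * Re (\<Sum>\<mu><N a b c. \<Sum>\<nu><N b a c. ?R a b c \<mu> \<nu> * R' b a c \<nu> \<mu>)"
        by (simp only: sum_subtractf sum.distrib Re_sum sum_distrib_left)
      moreover have "(\<Sum>\<mu><N a b c. \<Sum>\<nu><N b a c. ?R a b c \<mu> \<nu> * R' b a c \<nu> \<mu>) = of_nat (N a b c)"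
        using inv[of a b c] unfolding inverse_matrices_on_def by simp
      ultimately show ?thesis using sum.swap[of "\<lambda>\<mu> \<nu>. (cmod (R' b a c \<nu> \<mu>))\<^sup>2"] by simp
    qed
    have norms: "(\<Sum>e\<in>UNIV. d e * (\<Sum>\<alpha><N a b e. \<Sum>\<alpha>'<N b a e. (cmod (?R a b e \<alpha> \<alpha>'))\<^sup>2)) = d a * d b"
      "(\<Sum>e\<in>UNIV. d e * (\<Sum>\<alpha><N b a e. \<Sum>\<alpha>'<N a b e. (cmod (R' b a e \<alpha> \<alpha>'))\<^sup>2)) = d b * d a"
      using hexagon_norm[OF hex(1) exI, OF inv] hexagon_norm[OF hex(2) exI, OF inv'] by blast+
    have "(\<Sum>c\<in>UNIV. d c * ?D c) = d a * d b + d b * d a - 2 * (\<Sum>c\<in>UNIV. real (N a b c) * d c)"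
      unfolding D norms[symmetric]
      by (simp add: algebra_simps sum.distrib sum_subtractf sum_distrib_left)
    then have "(\<Sum>c\<in>UNIV. d c * ?D c) = 0"
      using d_mult[of a b] mult.commute[of "d a" "d b"] by linarith
    then have "d c * ?D c = 0"
      by (subst (asm) sum_nonneg_eq_0_iff) (auto intro!: sum_nonneg mult_nonneg_nonneg less_imp_le[OF d_pos])
    then have "?D c = 0" by simp
    then show ?thesis using that by (simp add: sum_nonneg_eq_0_iff sum_nonneg)
  qed
  then show ?thesis
    using inv unfolding R_unitary_def unitary_matrix_on_def inverse_matrices_on_def by simp
qed

end

section \<open>Galois conjugation and gauge transformations\<close>

text \<open>A relation rather than a function: \<open>galois_conjugate\<close> maps junk entries as
  well, and an extension of \<open>q\<close> need agree with \<open>q\<close> only on the entries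
  inside the index ranges.\<close>

definition conjugate_data ::
  "(complex \<Rightarrow> complex) \<Rightarrow> ('a::finite) mtc_data \<Rightarrow> 'a mtc_data \<Rightarrow> bool" where
  "conjugate_data \<sigma> C D \<longleftrightarrow>
     vac D = vac C \<and> dual D = dual C \<and> fus D = fus C \<and> piv D = piv C \<and>
     (\<forall>a b c d. \<forall>i\<in>F_rows C a b c d. \<forall>j\<in>F_cols C a b c d. Fsym D a b c d i j = \<sigma> (Fsym C a b c d i j)) \<and>
     (\<forall>a b c. \<forall>\<mu><fus C a b c. \<forall>\<nu><fus C b a c. Rsym D a b c \<mu> \<nu> = \<sigma> (Rsym C a b c \<mu> \<nu>))"

lemma finite_entries4:
  fixes M :: "'a::finite \<Rightarrow> 'b::finite \<Rightarrow> 'c::finite \<Rightarrow> 'd::finite \<Rightarrow> 'i \<Rightarrow> 'j \<Rightarrow> complex"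
  assumes "\<And>a b c d. finite (I a b c d)" "\<And>a b c d. finite (J a b c d)"
  shows "finite {M a b c d i j | a b c d i j. i \<in> I a b c d \<and> j \<in> J a b c d}"
proof -
  have "{M a b c d i j | a b c d i j. i \<in> I a b c d \<and> j \<in> J a b c d} \<subseteq>
      (\<Union>a. \<Union>b. \<Union>c. \<Union>d. \<Union>i\<in>I a b c d. \<Union>j\<in>J a b c d. {M a b c d i j})" (is "_ \<subseteq> ?U")
  proof (rule subsetI, elim CollectE exE conjE)
    fix x a b c d i j assume x: "x = M a b c d i j" "i \<in> I a b c d" "j \<in> J a b c d"
    show "x \<in> ?U" unfolding x(1)
      by (rule UN_I[OF UNIV_I[of a]], rule UN_I[OF UNIV_I[of b]], rule UN_I[OF UNIV_I[of c]],
          rule UN_I[OF UNIV_I[of d]], rule UN_I[OF x(2)], rule UN_I[OF x(3)], rule singletonI)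
  qed
  then show ?thesis by (rule finite_subset) (use assms in simp)
qed

lemma finite_entries3:
  fixes M :: "'a::finite \<Rightarrow> 'b::finite \<Rightarrow> 'c::finite \<Rightarrow> nat \<Rightarrow> nat \<Rightarrow> complex"
  shows "finite {M a b c \<mu> \<nu> | a b c \<mu> \<nu>. \<mu> < m a b c \<and> \<nu> < n a b c}"
proof -
  have "{M a b c \<mu> \<nu> | a b c \<mu> \<nu>. \<mu> < m a b c \<and> \<nu> < n a b c} \<subseteq>
      (\<Union>a. \<Union>b. \<Union>c. \<Union>\<mu>\<in>{..<m a b c}. \<Union>\<nu>\<in>{..<n a b c}. {M a b c \<mu> \<nu>})" (is "_ \<subseteq> ?U")
  proof (rule subsetI, elim CollectE exE conjE)
    fix x a b c \<mu> \<nu> assume x: "x = M a b c \<mu> \<nu>" "\<mu> < m a b c" "\<nu> < n a b c"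
    show "x \<in> ?U" unfolding x(1)
      by (rule UN_I[OF UNIV_I[of a]], rule UN_I[OF UNIV_I[of b]], rule UN_I[OF UNIV_I[of c]],
          rule UN_I[of \<mu>], simp add: x, rule UN_I[of \<nu>], simp add: x, rule singletonI)
  qed
  then show ?thesis by (rule finite_subset) simp
qed

lemma finite_F_entries: "finite (F_entries (C :: ('a::finite) mtc_data))"
  and finite_R_entries: "finite (R_entries (C :: ('a::finite) mtc_data))"
  unfolding F_entries_def R_entries_def by (intro finite_entries4 finite_entries3 finite_F_rows finite_F_cols)+

lemma (in subfield_embedding) inverse_matrices_on_hom:
  assumes "inverse_matrices_on I J A G"
    and "\<And>i j. i \<in> I \<Longrightarrow> j \<in> J \<Longrightarrow> A i j \<in> L \<and> A' i j = \<sigma> (A i j)"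
    and "\<And>i j. i \<in> I \<Longrightarrow> j \<in> J \<Longrightarrow> G j i \<in> L \<and> G' j i = \<sigma> (G j i)"
  shows "inverse_matrices_on I J A' G'"
proof -
  have "(\<Sum>j\<in>J. A' i j * G' j i') = \<sigma> (\<Sum>j\<in>J. A i j * G j i')" if "i \<in> I" "i' \<in> I" for i i'
    using assms(2,3) that by (simp add: sum mult)
  moreover have "(\<Sum>i\<in>I. G' j i * A' i j') = \<sigma> (\<Sum>i\<in>I. G j i * A i j')" if "j \<in> J" "j' \<in> J" for j j'
    using assms(2,3) that by (simp add: sum mult)
  ultimately show ?thesis
    using assms(1) unfolding inverse_matrices_on_def by simp
qed

context subfield_embedding
begin

lemma closed_sum_lessThan: "(\<And>i. i < n \<Longrightarrow> f i \<in> L) \<Longrightarrow> (\<Sum>i<n. f i) \<in> L"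
  and sum_lessThan: "(\<And>i. i < n \<Longrightarrow> f i \<in> L) \<Longrightarrow> \<sigma> (\<Sum>i<n. f i) = (\<Sum>i<n. \<sigma> (f i))"
  and closed_sum_UNIV: "(\<And>a. g a \<in> L) \<Longrightarrow> (\<Sum>a\<in>UNIV. g a) \<in> L"
  and sum_UNIV: "(\<And>a. g a \<in> L) \<Longrightarrow> \<sigma> (\<Sum>a\<in>UNIV. g a) = (\<Sum>a\<in>UNIV. \<sigma> (g a))"
  by (auto intro!: closed_sum sum)

lemmas hom_sums = closed_sum_lessThan sum_lessThan closed_sum_UNIV sum_UNIV

end

section \<open>The axioms of a modular tensor category along a field embedding\<close>

locale conjugation = subfield_embedding L \<sigma> for L \<sigma> +
  fixes C D :: "('a::finite) mtc_data"
  assumes mtc: "modular_tensor_category C"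
    and entries: "F_entries C \<union> R_entries C \<subseteq> L"
    and conj: "conjugate_data \<sigma> C D"
begin

lemma same [simp]: "vac D = vac C" "dual D = dual C" "fus D = fus C" "piv D = piv C"
  using conj unfolding conjugate_data_def by auto

lemma same_index [simp]: "F_rows D = F_rows C" "F_cols D = F_cols C"
  by (intro ext, simp add: F_rows_def F_cols_def)+

lemma F_mem: "i \<in> F_rows C a b c d \<Longrightarrow> j \<in> F_cols C a b c d \<Longrightarrow> Fsym C a b c d i j \<in> L"
  and R_mem: "\<mu> < fus C a b c \<Longrightarrow> \<nu> < fus C b a c \<Longrightarrow> Rsym C a b c \<mu> \<nu> \<in> L"
  using entries unfolding F_entries_def R_entries_def by blast+

lemma F_conj: "i \<in> F_rows C a b c d \<Longrightarrow> j \<in> F_cols C a b c d \<Longrightarrow> Fsym D a b c d i j = \<sigma> (Fsym C a b c d i j)"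
  and R_conj: "\<mu> < fus C a b c \<Longrightarrow> \<nu> < fus C b a c \<Longrightarrow> Rsym D a b c \<mu> \<nu> = \<sigma> (Rsym C a b c \<mu> \<nu>)"
  using conj unfolding conjugate_data_def by auto

lemma fusion: "fusion_rules C"
  using mtc unfolding modular_tensor_category_def by blast

lemma fus_vac [simp]: "fus C (vac C) a b = of_bool (a = b)" "fus C a (vac C) b = of_bool (a = b)"
    "fus C a b (vac C) = of_bool (b = dual C a)" "dual C (dual C a) = a"
  using fusion unfolding fusion_rules_def by auto

lemma piv_mem: "piv C a \<in> L" and piv_conj: "\<sigma> (piv C a) = piv C a" and piv_cases: "piv C a = 1 \<or> piv C a = - 1"
proof -
  show *: "piv C a = 1 \<or> piv C a = - 1"
    using mtc unfolding modular_tensor_category_def pivotal_def by blast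
  show "piv C a \<in> L" "\<sigma> (piv C a) = piv C a" using * uminus[of 1] by auto
qed

lemma qdim_mem: "qdim C a \<in> L" and qdim_conj: "qdim D a = \<sigma> (qdim C a)"
  unfolding qdim_def by (simp_all add: F_mem F_conj piv_mem piv_conj divide)

lemma fusion_rules_conj: "fusion_rules D"
  using fusion unfolding fusion_rules_def same .

lemma pentagon_conj: "pentagon D"
  unfolding pentagon_def same
proof (intro allI impI)
  fix a b c d e f g k l and \<alpha> \<beta> \<gamma> \<delta> \<kappa> \<mu>
  assume r: "\<alpha> < fus C a b f" "\<beta> < fus C f c g" "\<gamma> < fus C g d e"
    "\<delta> < fus C c d l" "\<kappa> < fus C b l k" "\<mu> < fus C a k e"
  have "(\<Sum>\<sigma><fus C f l e. Fsym C f c d e (g, \<beta>, \<gamma>) (l, \<delta>, \<sigma>) * Fsym C a b l e (f, \<alpha>, \<sigma>) (k, \<kappa>, \<mu>)) =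
      (\<Sum>h\<in>UNIV. \<Sum>\<eta><fus C b c h. \<Sum>\<psi><fus C a h g. \<Sum>\<rho><fus C h d k.
            Fsym C a b c g (f, \<alpha>, \<beta>) (h, \<eta>, \<psi>) * Fsym C a h d e (g, \<psi>, \<gamma>) (k, \<rho>, \<mu>) *
            Fsym C b c d k (h, \<eta>, \<rho>) (l, \<delta>, \<kappa>))" (is "?l = ?r")
    using mtc r unfolding modular_tensor_category_def pentagon_def by blast
  then have "\<sigma> ?l = \<sigma> ?r" by (rule arg_cong)
  then show "(\<Sum>\<sigma><fus C f l e. Fsym D f c d e (g, \<beta>, \<gamma>) (l, \<delta>, \<sigma>) * Fsym D a b l e (f, \<alpha>, \<sigma>) (k, \<kappa>, \<mu>)) =
      (\<Sum>h\<in>UNIV. \<Sum>\<eta><fus C b c h. \<Sum>\<psi><fus C a h g. \<Sum>\<rho><fus C h d k.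
            Fsym D a b c g (f, \<alpha>, \<beta>) (h, \<eta>, \<psi>) * Fsym D a h d e (g, \<psi>, \<gamma>) (k, \<rho>, \<mu>) *
            Fsym D b c d k (h, \<eta>, \<rho>) (l, \<delta>, \<kappa>))"
    using r by (simp add: hom_sums mult F_mem F_conj)
qed

lemma triangle_conj: "triangle D"
  using mtc unfolding modular_tensor_category_def triangle_def same
  by (simp add: F_conj)

lemma rigid_conj: "rigid D"
  using mtc unfolding modular_tensor_category_def rigid_def same
  by (simp add: F_conj F_mem eq_0_iff)

text \<open>The family \<open>R\<close> is arbitrary so that the braiding and its inverse are both
  covered.\<close>

lemma hexagon_conj:
  assumes hex: "hexagon C R"
    and R: "\<And>a b c \<mu> \<nu>. \<mu> < fus C a b c \<Longrightarrow> \<nu> < fus C b a c \<Longrightarrow> R a b c \<mu> \<nu> \<in> L \<and> R' a b c \<mu> \<nu> = \<sigma> (R a b c \<mu> \<nu>)"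
  shows "hexagon D R'"
  unfolding hexagon_def same
proof (intro allI impI)
  fix a b c d e g \<alpha> \<beta> \<sigma>' \<tau>
  assume r: "\<alpha> < fus C a b e" "\<beta> < fus C e c d" "\<sigma>' < fus C c a g" "\<tau> < fus C b g d"
  have "(\<Sum>f\<in>UNIV. \<Sum>\<mu><fus C b c f. \<Sum>\<nu><fus C a f d. \<Sum>\<rho><fus C f a d.
            Fsym C a b c d (e, \<alpha>, \<beta>) (f, \<mu>, \<nu>) * R a f d \<nu> \<rho> * Fsym C b c a d (f, \<mu>, \<rho>) (g, \<sigma>', \<tau>)) =
        (\<Sum>\<alpha>'<fus C b a e. \<Sum>\<nu><fus C a c g.
            R a b e \<alpha> \<alpha>' * Fsym C b a c d (e, \<alpha>', \<beta>) (g, \<nu>, \<tau>) * R a c g \<nu> \<sigma>')" (is "?l = ?r")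
    using hex r unfolding hexagon_def by blast
  then have "\<sigma> ?l = \<sigma> ?r" by (rule arg_cong)
  then show "(\<Sum>f\<in>UNIV. \<Sum>\<mu><fus C b c f. \<Sum>\<nu><fus C a f d. \<Sum>\<rho><fus C f a d.
            Fsym D a b c d (e, \<alpha>, \<beta>) (f, \<mu>, \<nu>) * R' a f d \<nu> \<rho> * Fsym D b c a d (f, \<mu>, \<rho>) (g, \<sigma>', \<tau>)) =
        (\<Sum>\<alpha>'<fus C b a e. \<Sum>\<nu><fus C a c g.
            R' a b e \<alpha> \<alpha>' * Fsym D b a c d (e, \<alpha>', \<beta>) (g, \<nu>, \<tau>) * R' a c g \<nu> \<sigma>')"
    using r by (simp add: hom_sums mult F_mem F_conj R)
qed

lemma pivotal_conj: "pivotal D"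
  unfolding pivotal_def same
proof (intro conjI allI impI)
  show "piv C a \<in> {1, - 1}" for a using piv_cases[of a] by simp
  fix a b c \<alpha> \<alpha>' assume r: "\<alpha> < fus C a b (dual C c)" "\<alpha>' < fus C a b (dual C c)"
  have "(\<Sum>\<mu><fus C b c (dual C a). \<Sum>\<nu><fus C c a (dual C b).
            Fsym C a b c (vac C) (dual C c, \<alpha>, 0) (dual C a, \<mu>, 0) *
            Fsym C b c a (vac C) (dual C a, \<mu>, 0) (dual C b, \<nu>, 0) *
            Fsym C c a b (vac C) (dual C b, \<nu>, 0) (dual C c, \<alpha>', 0)) =
        piv C a * piv C b * piv C c * of_bool (\<alpha> = \<alpha>')" (is "?l = ?r")
    using mtc r unfolding modular_tensor_category_def pivotal_def by blast
  then have "\<sigma> ?l = \<sigma> ?r" by (rule arg_cong)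
  then show "(\<Sum>\<mu><fus C b c (dual C a). \<Sum>\<nu><fus C c a (dual C b).
            Fsym D a b c (vac C) (dual C c, \<alpha>, 0) (dual C a, \<mu>, 0) *
            Fsym D b c a (vac C) (dual C a, \<mu>, 0) (dual C b, \<nu>, 0) *
            Fsym D c a b (vac C) (dual C b, \<nu>, 0) (dual C c, \<alpha>', 0)) =
        piv C a * piv C b * piv C c * of_bool (\<alpha> = \<alpha>')"
    using r by (simp add: hom_sums mult F_mem F_conj piv_mem piv_conj)
qed

lemma spherical_conj: "spherical D"
  using mtc unfolding modular_tensor_category_def spherical_def same by (simp add: qdim_conj)

lemma S_matrix_mem: "S_matrix C $ a $ b \<in> L"
  and S_matrix_conj: "S_matrix D $ a $ b = \<sigma> (S_matrix C $ a $ b)"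
  unfolding S_matrix_def same by (simp_all add: hom_sums mult R_mem R_conj qdim_mem qdim_conj)

lemma invertible_S_matrix_conj:
  fixes T :: "complex ^ 'a ^ 'a"
  assumes T: "S_matrix C ** T = mat 1" "T ** S_matrix C = mat 1" and mem: "\<And>a b. T $ a $ b \<in> L"
  shows "invertible (S_matrix D)"
proof -
  let ?T = "\<chi> a b. \<sigma> (T $ a $ b)"
  have "(\<Sum>k\<in>UNIV. S_matrix D $ a $ k * \<sigma> (T $ k $ b)) = \<sigma> ((S_matrix C ** T) $ a $ b)" for a b
    by (simp add: matrix_matrix_mult_def S_matrix_conj sum mult mem S_matrix_mem)
  moreover have "(\<Sum>k\<in>UNIV. \<sigma> (T $ a $ k) * S_matrix D $ k $ b) = \<sigma> ((T ** S_matrix C) $ a $ b)" for a b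
    by (simp add: matrix_matrix_mult_def S_matrix_conj sum mult mem S_matrix_mem)
  ultimately have "S_matrix D ** ?T = mat 1" "?T ** S_matrix D = mat 1"
    unfolding T by (simp_all add: vec_eq_iff matrix_matrix_mult_def mat_def)
  then show ?thesis unfolding invertible_def by blast
qed

end

text \<open>The finite set consists of the entries of the inverse matrices whose existence the axioms
  assert; they need not lie in the field of definition of the data.\<close>

lemma modular_tensor_category_conj:
  fixes C :: "('a::finite) mtc_data"
  assumes mtc: "modular_tensor_category C"
  shows "\<exists>X. finite X \<and> (\<forall>L \<sigma> D. conjugation L \<sigma> C D \<longrightarrow> X \<subseteq> L \<longrightarrow> modular_tensor_category D)"
proof -
  have "\<forall>p. \<exists>G. case p of (a, b, c, d) \<Rightarrow>
      inverse_matrices_on (F_rows C a b c d) (F_cols C a b c d) (Fsym C a b c d) G"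
    using mtc unfolding modular_tensor_category_def F_invertible_def by auto
  then obtain G where G: "\<And>a b c d. inverse_matrices_on (F_rows C a b c d) (F_cols C a b c d) (Fsym C a b c d) (G (a, b, c, d))"
    unfolding choice_iff by auto
  obtain R' where R': "\<And>a b c. inverse_matrices_on {..<fus C a b c} {..<fus C b a c} (Rsym C a b c) (R' b a c)"
    and hex: "hexagon C (Rsym C)" "hexagon C R'"
    using mtc unfolding modular_tensor_category_def braided_def by blast
  obtain T where T: "S_matrix C ** T = mat 1" "T ** S_matrix C = mat 1"
    using mtc unfolding modular_tensor_category_def invertible_def by blast
  define XG where "XG = {G (a, b, c, d) j i | a b c d j i. j \<in> F_cols C a b c d \<and> i \<in> F_rows C a b c d}"
  define XR where "XR = {R' a b c \<mu> \<nu> | a b c \<mu> \<nu>. \<mu> < fus C a b c \<and> \<nu> < fus C b a c}"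
  define XT where "XT = (\<lambda>(a, b). T $ a $ b) ` UNIV"
  have fin: "finite (XG \<union> XR \<union> XT)"
    unfolding XG_def XR_def XT_def
    by (intro finite_UnI finite_entries4 finite_entries3 finite_F_rows finite_F_cols finite_imageI finite)
  have "modular_tensor_category D" if cj: "conjugation L \<sigma> C D" and X: "XG \<union> XR \<union> XT \<subseteq> L" for L \<sigma> D
  proof -
    interpret conjugation L \<sigma> C D by fact
    have XG: "G (a, b, c, d) j i \<in> L" if "i \<in> F_rows C a b c d" "j \<in> F_cols C a b c d" for a b c d i j
    proof (rule subsetD[OF X], intro UnI1)
      show "G (a, b, c, d) j i \<in> XG" unfolding XG_def using that by (intro CollectI exI conjI) (rule refl)
    qed
    have XR: "R' a b c \<mu> \<nu> \<in> L" if "\<mu> < fus C a b c" "\<nu> < fus C b a c" for a b c \<mu> \<nu>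
    proof (rule subsetD[OF X], rule UnI1, rule UnI2)
      show "R' a b c \<mu> \<nu> \<in> XR" unfolding XR_def using that by (intro CollectI exI conjI) (rule refl)
    qed
    have XT: "T $ a $ b \<in> L" for a b
    proof (rule subsetD[OF X], rule UnI2)
      show "T $ a $ b \<in> XT" unfolding XT_def by (rule image_eqI[of _ _ "(a, b)"]) simp_all
    qed
    have "F_invertible D"
      unfolding F_invertible_def same_index
    proof (intro allI exI)
      fix a b c d
      show "inverse_matrices_on (F_rows C a b c d) (F_cols C a b c d) (Fsym D a b c d) (\<lambda>j i. \<sigma> (G (a, b, c, d) j i))"
        by (rule inverse_matrices_on_hom[OF G]) (simp_all add: F_mem F_conj XG)
    qed
    moreover have "braided D"
      unfolding braided_def same
    proof (intro conjI exI allI)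
      show "hexagon D (Rsym D)" by (rule hexagon_conj[OF hex(1)]) (simp add: R_mem R_conj)
      show "hexagon D (\<lambda>a b c \<mu> \<nu>. \<sigma> (R' a b c \<mu> \<nu>))" by (rule hexagon_conj[OF hex(2)]) (simp add: XR)
      show "inverse_matrices_on {..<fus C a b c} {..<fus C b a c} (Rsym D a b c) (\<lambda>\<mu> \<nu>. \<sigma> (R' b a c \<mu> \<nu>))" for a b c
        by (rule inverse_matrices_on_hom[OF R']) (simp_all add: R_mem R_conj XR)
    qed
    ultimately show ?thesis
      unfolding modular_tensor_category_def
      using fusion_rules_conj pentagon_conj triangle_conj rigid_conj pivotal_conj spherical_conj
        invertible_S_matrix_conj[OF T XT] by blast
  qed
  then show ?thesis using fin by (intro exI[of _ "XG \<union> XR \<union> XT"] conjI allI impI)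
qed

text \<open>Conjugating \<open>U\<close> entrywise works as soon as the embedding is defined on the
  entries of \<open>U\<close> and of its inverse matrices; these need not lie in the fields of
  either gauge and make up the finite set.\<close>

lemma gauge_transformed_conj:
  fixes C C' :: "('a::finite) mtc_data"
  assumes gt: "gauge_transformed U C C'"
  shows "\<exists>X. finite X \<and> (\<forall>L \<sigma> D D'. conjugation L \<sigma> C D \<longrightarrow> conjugation L \<sigma> C' D' \<longrightarrow> X \<subseteq> L \<longrightarrow>
    (\<exists>U'. gauge_transformed U' D D'))"
proof -
  have sm: "vac C' = vac C" "dual C' = dual C" "fus C' = fus C"
    and inv: "\<And>a b c. \<exists>V. inverse_matrices_on {..<fus C a b c} {..<fus C a b c} (U a b c) V"
    and gF: "\<And>a b c d e f \<alpha> \<beta> \<mu> \<nu>. (e, \<alpha>, \<beta>) \<in> F_rows C a b c d \<Longrightarrow> (f, \<mu>, \<nu>) \<in> F_cols C a b c d \<Longrightarrow>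
        (\<Sum>\<mu>'<fus C b c f. \<Sum>\<nu>'<fus C a f d.
            Fsym C' a b c d (e, \<alpha>, \<beta>) (f, \<mu>', \<nu>') * U b c f \<mu>' \<mu> * U a f d \<nu>' \<nu>) =
        (\<Sum>\<alpha>'<fus C a b e. \<Sum>\<beta>'<fus C e c d.
            U a b e \<alpha> \<alpha>' * U e c d \<beta> \<beta>' * Fsym C a b c d (e, \<alpha>', \<beta>') (f, \<mu>, \<nu>))"
    and gR: "\<And>a b c \<mu> \<nu>. \<mu> < fus C a b c \<Longrightarrow> \<nu> < fus C b a c \<Longrightarrow>
        (\<Sum>\<nu>'<fus C b a c. Rsym C' a b c \<mu> \<nu>' * U b a c \<nu>' \<nu>) =
        (\<Sum>\<mu>'<fus C a b c. U a b c \<mu> \<mu>' * Rsym C a b c \<mu>' \<nu>)"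
    and gp: "\<And>a. piv C' a * U a (dual C a) (vac C) 0 0 = piv C a * U (dual C a) a (vac C) 0 0"
    using gt unfolding gauge_transformed_def by blast+
  have "\<forall>p. \<exists>V. case p of (a, b, c) \<Rightarrow> inverse_matrices_on {..<fus C a b c} {..<fus C a b c} (U a b c) V"
    using inv by auto
  then obtain V where V: "\<And>a b c. inverse_matrices_on {..<fus C a b c} {..<fus C a b c} (U a b c) (V (a, b, c))"
    unfolding choice_iff by auto
  define X where "X = {U a b c \<mu> \<nu> | a b c \<mu> \<nu>. \<mu> < fus C a b c \<and> \<nu> < fus C a b c} \<union>
    {V (a, b, c) \<mu> \<nu> | a b c \<mu> \<nu>. \<mu> < fus C a b c \<and> \<nu> < fus C a b c}"
  have fin: "finite X" 
    unfolding X_def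
    by (rule finite_UnI[OF finite_entries3[of U "fus C" "fus C"]
          finite_entries3[of "\<lambda>a b c. V (a, b, c)" "fus C" "fus C"]])
  have main: "gauge_transformed (\<lambda>a b c \<mu> \<nu>. \<sigma> (U a b c \<mu> \<nu>)) D D'"
    if c1: "conjugation L \<sigma> C D" and c2: "conjugation L \<sigma> C' D'" and XL: "X \<subseteq> L" for L \<sigma> D D'
  proof -
    interpret C: conjugation L \<sigma> C D by fact
    interpret C': conjugation L \<sigma> C' D' by fact
    have U: "U a b c \<mu> \<nu> \<in> L" "V (a, b, c) \<mu> \<nu> \<in> L" if "\<mu> < fus C a b c" "\<nu> < fus C a b c" for a b c \<mu> \<nu>
    proof -
      have "U a b c \<mu> \<nu> \<in> X" unfolding X_def using that by (intro UnI1 CollectI exI conjI) (rule refl)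
      then show "U a b c \<mu> \<nu> \<in> L" using XL by (rule subsetD[rotated])
      have "V (a, b, c) \<mu> \<nu> \<in> X" unfolding X_def using that by (intro UnI2 CollectI exI conjI) (rule refl)
      then show "V (a, b, c) \<mu> \<nu> \<in> L" using XL by (rule subsetD[rotated])
    qed
    have index': "F_rows C' = F_rows C" "F_cols C' = F_cols C"
      by (intro ext, simp add: F_rows_def F_cols_def sm)+
    note F_mem' = C'.F_mem[unfolded index'] and F_conj' = C'.F_conj[unfolded index']
      and R_mem' = C'.R_mem[unfolded sm] and R_conj' = C'.R_conj[unfolded sm]
    show ?thesis
      unfolding gauge_transformed_def C.same C'.same sm C.same_index
    proof (intro conjI allI impI)
      fix a b c
      show "\<exists>V. inverse_matrices_on {..<fus C a b c} {..<fus C a b c} (\<lambda>\<mu> \<nu>. \<sigma> (U a b c \<mu> \<nu>)) V"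
        by (intro exI[of _ "\<lambda>\<mu> \<nu>. \<sigma> (V (a, b, c) \<mu> \<nu>)"] C.inverse_matrices_on_hom[OF V]) (simp_all add: U)
    next
      fix a b c d e f \<alpha> \<beta> \<mu> \<nu>
      assume r: "(e, \<alpha>, \<beta>) \<in> F_rows C a b c d" "(f, \<mu>, \<nu>) \<in> F_cols C a b c d"
      from arg_cong[OF gF[OF r], of \<sigma>] r
      show "(\<Sum>\<mu>'<fus C b c f. \<Sum>\<nu>'<fus C a f d.
            Fsym D' a b c d (e, \<alpha>, \<beta>) (f, \<mu>', \<nu>') * \<sigma> (U b c f \<mu>' \<mu>) * \<sigma> (U a f d \<nu>' \<nu>)) =
        (\<Sum>\<alpha>'<fus C a b e. \<Sum>\<beta>'<fus C e c d.
            \<sigma> (U a b e \<alpha> \<alpha>') * \<sigma> (U e c d \<beta> \<beta>') * Fsym D a b c d (e, \<alpha>', \<beta>') (f, \<mu>, \<nu>))"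
        by (simp add: C.hom_sums C.mult U C.F_mem C.F_conj F_mem' F_conj')
    next
      fix a b c \<mu> \<nu> assume r: "\<mu> < fus C a b c" "\<nu> < fus C b a c"
      from arg_cong[OF gR[OF r], of \<sigma>] r
      show "(\<Sum>\<nu>'<fus C b a c. Rsym D' a b c \<mu> \<nu>' * \<sigma> (U b a c \<nu>' \<nu>)) =
        (\<Sum>\<mu>'<fus C a b c. \<sigma> (U a b c \<mu> \<mu>') * Rsym D a b c \<mu>' \<nu>)"
        by (simp add: C.hom_sums C.mult U C.R_mem C.R_conj R_mem' R_conj')
    next
      fix a
      from arg_cong[OF gp[of a], of \<sigma>]
      show "piv C' a * \<sigma> (U a (dual C a) (vac C) 0 0) = piv C a * \<sigma> (U (dual C a) a (vac C) 0 0)"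
        by (simp add: C.mult U C.piv_mem C.piv_conj C'.piv_mem C'.piv_conj)
    qed simp_all
  qed
  show ?thesis
  proof (intro exI[of _ X] conjI allI impI)
    show "\<exists>U'. gauge_transformed U' D D'"
      if "conjugation L \<sigma> C D" "conjugation L \<sigma> C' D'" "X \<subseteq> L" for L \<sigma> D D'
      by (rule exI, rule main[OF that])
  qed (rule fin)
qed

text \<open>The triangle axioms in both gauges force all basis changes with a vacuum leg to be one
  common scalar. The vacuum entry of \<open>F\<close> is then rescaled by the ratio of the basis
  changes for \<open>a\<close>, \<open>st a\<close> and for \<open>st a\<close>, \<open>a\<close>.
  The pivotal coefficient is rescaled by the same ratio up to inversion, and the ratio is a
  sign.\<close>

lemma qdim_gauge_invariant:
  fixes C C' :: "('a::finite) mtc_data"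
  assumes mtc: "modular_tensor_category C" "modular_tensor_category C'"
    and gt: "gauge_transformed U C C'"
  shows "qdim C' a = qdim C a"
proof -
  have sm: "vac C' = vac C" "dual C' = dual C" "fus C' = fus C"
    and inv: "\<And>a b c. \<exists>V. inverse_matrices_on {..<fus C a b c} {..<fus C a b c} (U a b c) V"
    and gF: "\<And>a b c d e f \<alpha> \<beta> \<mu> \<nu>. (e, \<alpha>, \<beta>) \<in> F_rows C a b c d \<Longrightarrow> (f, \<mu>, \<nu>) \<in> F_cols C a b c d \<Longrightarrow>
        (\<Sum>\<mu>'<fus C b c f. \<Sum>\<nu>'<fus C a f d.
            Fsym C' a b c d (e, \<alpha>, \<beta>) (f, \<mu>', \<nu>') * U b c f \<mu>' \<mu> * U a f d \<nu>' \<nu>) =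
        (\<Sum>\<alpha>'<fus C a b e. \<Sum>\<beta>'<fus C e c d.
            U a b e \<alpha> \<alpha>' * U e c d \<beta> \<beta>' * Fsym C a b c d (e, \<alpha>', \<beta>') (f, \<mu>, \<nu>))"
    and gp: "\<And>a. piv C' a * U a (dual C a) (vac C) 0 0 = piv C a * U (dual C a) a (vac C) 0 0"
    using gt unfolding gauge_transformed_def by blast+
  let ?v = "vac C" and ?s = "dual C"
  have fus: "fus C ?v a b = of_bool (a = b)" "fus C a ?v b = of_bool (a = b)"
    "fus C a b ?v = of_bool (b = ?s a)" "?s (?s a) = a" for a b
    using mtc(1) unfolding modular_tensor_category_def fusion_rules_def by auto
  have sv: "?s ?v = ?v" using fus(1)[of ?v ?v] fus(3)[of ?v ?v] by (metis of_bool_eq_1_iff)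
  have tri: "Fsym X b (vac X) c d (b, 0, \<beta>) (c, 0, \<mu>) = of_bool (\<beta> = \<mu>)"
    if "modular_tensor_category X" "\<beta> < fus X b c d" "\<mu> < fus X b c d" for X :: "'a mtc_data" and b c d \<beta> \<mu>
    using that unfolding modular_tensor_category_def triangle_def by blast
  have nz: "U a b c 0 0 \<noteq> 0" if "fus C a b c = 1" for a b c
    using inv[of a b c] that unfolding inverse_matrices_on_def by (auto simp: lessThan_Suc)
  \<comment> \<open>In the gauge relation for the triple vacuum, vacuum, \<open>c\<close> both
    \<open>F\<close> entries are \<open>1\<close>, and one nonzero factor cancels.\<close>
  have left: "U ?v c c 0 0 = U ?v ?v ?v 0 0" for c
    using gF[of ?v 0 0 ?v ?v c c c 0 0] nz[of ?v c c] tri[OF mtc(1), of 0 ?v c c 0] tri[OF mtc(2), of 0 ?v c c 0]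
    by (simp add: fus sv sm)
  have right: "U c ?v c 0 0 = U ?v ?v ?v 0 0" for c
    using gF[of c 0 0 c ?v ?v c ?v 0 0] nz[of c ?v c] tri[OF mtc(1), of 0 c ?v c 0] tri[OF mtc(2), of 0 c ?v c 0]
    by (simp add: fus sv sm)
  let ?f = "Fsym C a (?s a) a a (?v, 0, 0) (?v, 0, 0)" and ?f' = "Fsym C' a (?s a) a a (?v, 0, 0) (?v, 0, 0)"
  have piv: "piv C a = 1 \<or> piv C a = - 1" "piv C' a = 1 \<or> piv C' a = - 1"
    using mtc unfolding modular_tensor_category_def pivotal_def by blast+
  then have "piv C a * piv C a = 1" by auto
  then have "U (?s a) a ?v 0 0 = (piv C a * piv C' a) * U a (?s a) ?v 0 0"
    using gp[of a] by (metis mult.assoc mult_1_left)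
  moreover have "?f' * U (?s a) a ?v 0 0 = U a (?s a) ?v 0 0 * ?f"
    using gF[of ?v 0 0 a "?s a" a a ?v 0 0] nz[of ?v ?v ?v] left[of a] right[of a] by (simp add: fus sv)
  ultimately have "(?f' * (piv C a * piv C' a)) * U a (?s a) ?v 0 0 = ?f * U a (?s a) ?v 0 0"
    by (simp add: mult_ac)
  moreover have "U a (?s a) ?v 0 0 \<noteq> 0" by (rule nz) (simp add: fus)
  ultimately have f: "?f = ?f' * (piv C a * piv C' a)" by simp
  have "?f' \<noteq> 0"
    using mtc(2) unfolding modular_tensor_category_def rigid_def sm by blast
  then show ?thesis
    using piv unfolding qdim_def sm f by auto
qed

theorem theorem2p3:
  fixes C :: "('a::finite) mtc_data" and q :: "complex \<Rightarrow> complex"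
  assumes "unitary_mtc C"
    and "number_field_gauge C"
    and "\<exists>C'. is_gauge_of C' C \<and> number_field_gauge C' \<and> F_unitary C' \<and>
           (totally_real_field (F_number_field C') \<or> CM_field (F_number_field C'))"
    and "q \<in> Gal_rat (defining_number_field C)"
    and "\<forall>a. q (qdim C a) = qdim C a"
  shows "unitary_mtc (galois_conjugate q C) \<and>
         (\<exists>D. unitary_tqft (galois_conjugate q C) D)"
proof -
  obtain C0 U0 where mtc: "modular_tensor_category C" "modular_tensor_category C0"
    and gt0: "gauge_transformed U0 C C0" and pos0: "\<And>a. qdim C0 a \<in> \<real> \<and> 0 < Re (qdim C0 a)"
    using assms(1) unfolding unitary_mtc_def is_gauge_of_def by blast
  \<comment> \<open>The gauge with arithmetic control over \<open>F\<close> comes without positive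
    dimensions. These are taken from the unitary gauge \<open>C0\<close> and transported through
    \<open>C\<close>.\<close>
  have pos: "qdim C a \<in> \<real>" "0 < Re (qdim C a)" for a
    using pos0[of a] qdim_gauge_invariant[OF mtc gt0] by simp_all
  obtain C' U where mtc': "modular_tensor_category C'" and gt: "gauge_transformed U C C'"
    and F_unitary': "F_unitary C'"
    and real_or_CM: "totally_real_field (F_number_field C') \<or> CM_field (F_number_field C')"
    using assms(3) unfolding is_gauge_of_def by blast
  let ?K = "F_number_field C'" and ?L0 = "field_generated (F_entries C \<union> R_entries C)"
  have "number_field ?K"
    using real_or_CM unfolding CM_field_def totally_real_field_def totally_imaginary_field_def by blast
  \<comment> \<open>A finite spanning set over the rationals: once it lies in the extended field, so
    does all of \<open>?K\<close>, which must be inside the domain for the totally real or CM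
    property to apply to the extension.\<close>
  then obtain B where B: "finite B" "B \<subseteq> ?K" "\<And>x. x \<in> ?K \<Longrightarrow> \<exists>r :: complex \<Rightarrow> rat. x = (\<Sum>b\<in>B. of_rat (r b) * b)"
    unfolding number_field_def by blast
  obtain X where X: "finite X" "\<And>L \<sigma> D. conjugation L \<sigma> C D \<Longrightarrow> X \<subseteq> L \<Longrightarrow> modular_tensor_category D"
    using modular_tensor_category_conj[OF mtc(1)] by blast
  obtain X' where X': "finite X'" "\<And>L \<sigma> D. conjugation L \<sigma> C' D \<Longrightarrow> X' \<subseteq> L \<Longrightarrow> modular_tensor_category D"
    using modular_tensor_category_conj[OF mtc'] by blast
  obtain Y where Y: "finite Y" "\<And>L \<sigma> D D'. conjugation L \<sigma> C D \<Longrightarrow> conjugation L \<sigma> C' D' \<Longrightarrow> Y \<subseteq> L \<Longrightarrow>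
      \<exists>U'. gauge_transformed U' D D'"
    using gauge_transformed_conj[OF gt] by blast
  have "field_embedding_on ?L0 q"
    using assms(4) field_embedding_on_subset[OF _ normal_closure_rat_superset]
    unfolding Gal_rat_def defining_number_field_def by blast
  then have "subfield_embedding ?L0 q"
    by (simp add: subfield_embedding_def complex_subfield_field_generated)
  moreover have "countable ?L0"
    using assms(2) number_field_countable unfolding number_field_gauge_def by blast
  moreover have "finite (X \<union> X' \<union> Y \<union> B \<union> F_entries C' \<union> R_entries C')"
    using X(1) X'(1) Y(1) B(1) by (simp add: finite_F_entries finite_R_entries)
  ultimately obtain L \<sigma> where emb: "subfield_embedding L \<sigma>" and L0: "?L0 \<subseteq> L"
    and XL: "X \<union> X' \<union> Y \<union> B \<union> F_entries C' \<union> R_entries C' \<subseteq> L" and \<sigma>q: "\<And>z. z \<in> ?L0 \<Longrightarrow> \<sigma> z = q z"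
    using extend_to_finite_set by meson
  interpret subfield_embedding L \<sigma> by (rule emb)
  have KL: "?K \<subseteq> L"
  proof
    fix x assume "x \<in> ?K"
    then obtain r :: "complex \<Rightarrow> rat" where x: "x = (\<Sum>b\<in>B. of_rat (r b) * b)" using B(3) by blast
    show "x \<in> L" unfolding x
    proof (rule closed_sum, rule closed(4))
      show "of_rat (r b) \<in> L" for b by (rule complex_subfield_of_rat[OF subfield])
      show "b \<in> L" if "b \<in> B" for b using that XL by blast
    qed
  qed
  \<comment> \<open>The second gauge is conjugated by the extension \<open>\<sigma>\<close>, since
    \<open>q\<close> need not be meaningful on the entries of \<open>C'\<close>.\<close>
  let ?D = "galois_conjugate q C" and ?D' = "galois_conjugate \<sigma> C'"
  have entries: "F_entries C \<union> R_entries C \<subseteq> ?L0" by (rule field_generated_superset)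
  have "conjugate_data \<sigma> C ?D"
    unfolding conjugate_data_def
  proof (intro conjI allI ballI impI)
    fix a b c d i j assume "i \<in> F_rows C a b c d" "j \<in> F_cols C a b c d"
    then have "Fsym C a b c d i j \<in> F_entries C" unfolding F_entries_def by blast
    then show "Fsym ?D a b c d i j = \<sigma> (Fsym C a b c d i j)"
      using entries by (subst \<sigma>q) (auto simp: galois_conjugate_def)
  next
    fix a b c \<mu> \<nu> assume "\<mu> < fus C a b c" "\<nu> < fus C b a c"
    then have "Rsym C a b c \<mu> \<nu> \<in> R_entries C" unfolding R_entries_def by blast
    then show "Rsym ?D a b c \<mu> \<nu> = \<sigma> (Rsym C a b c \<mu> \<nu>)"
      using entries by (subst \<sigma>q) (auto simp: galois_conjugate_def)
  qed (simp_all add: galois_conjugate_def)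
  then have cD: "conjugation L \<sigma> C ?D"
    using mtc(1) entries L0 by unfold_locales auto
  have cD': "conjugation L \<sigma> C' ?D'"
    using mtc' XL by unfold_locales (auto simp: conjugate_data_def galois_conjugate_def)
  have mtcD: "modular_tensor_category ?D" by (rule X(2)[OF cD]) (use XL in auto)
  have mtcD': "modular_tensor_category ?D'" by (rule X'(2)[OF cD']) (use XL in auto)
  obtain U' where gtD: "gauge_transformed U' ?D ?D'" using Y(2)[OF cD cD'] XL by blast
  interpret D: conjugation L \<sigma> C ?D by (rule cD)
  interpret D': conjugation L \<sigma> C' ?D' by (rule cD')
  \<comment> \<open>The trivial conjugation of \<open>C\<close> by \<open>id\<close> makes
    \<open>qdim_mem\<close> available over \<open>?L0\<close>, the field on which
    \<open>\<sigma>\<close> agrees with \<open>q\<close>.\<close>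
  have "qdim C a \<in> ?L0" for a
  proof -
    interpret I: conjugation ?L0 id C C
      by unfold_locales
        (use mtc(1) entries in \<open>auto simp: field_embedding_on_def complex_subfield_field_generated conjugate_data_def\<close>)
    show ?thesis by (rule I.qdim_mem)
  qed
  then have qdimD: "qdim ?D a = qdim C a" for a
    using assms(5) by (simp add: D.qdim_conj \<sigma>q)
  then have qdimD': "qdim ?D' a = qdim C a" for a
    using qdim_gauge_invariant[OF mtcD mtcD' gtD] by simp
  \<comment> \<open>Restricted to \<open>?K\<close>, \<open>\<sigma>\<close> commutes with
    \<open>cnj\<close>, so applying it to the unitarity equations of \<open>F\<close> gives the
    unitarity equations of the conjugate.\<close>
  have "field_embedding_on ?K \<sigma>" using embedding KL by (rule field_embedding_on_subset)
  then have cnj: "cnj z \<in> ?K" "\<sigma> (cnj z) = cnj (\<sigma> z)" if "z \<in> ?K" for z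
    using that real_or_CM totally_real_commutes_cnj CM_field_commutes_cnj by blast+
  have "F_unitary ?D'"
    unfolding F_unitary_def unitary_matrix_on_def D'.same_index
  proof (intro allI)
    fix a b c d
    have FK: "Fsym C' a b c d i j \<in> ?K" if "i \<in> F_rows C' a b c d" "j \<in> F_cols C' a b c d" for i j
    proof -
      have "Fsym C' a b c d i j \<in> F_entries C'" using that unfolding F_entries_def by blast
      then show ?thesis
        using field_generated_superset normal_closure_rat_superset unfolding F_number_field_def by blast
    qed
    have "inverse_matrices_on (F_rows C' a b c d) (F_cols C' a b c d) (Fsym C' a b c d) (\<lambda>j i. cnj (Fsym C' a b c d i j))"
      using F_unitary' unfolding F_unitary_def unitary_matrix_on_def by blast
    then show "inverse_matrices_on (F_rows C' a b c d) (F_cols C' a b c d) (Fsym ?D' a b c d) (\<lambda>j i. cnj (Fsym ?D' a b c d i j))"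
      by (rule inverse_matrices_on_hom) (use FK KL cnj in \<open>auto simp: D'.F_conj\<close>)
  qed
  then interpret U: unitary_F_mtc ?D'
    using mtcD' pos by unfold_locales (simp_all add: qdimD')
  have unitary: "unitary_mtc ?D"
    unfolding unitary_mtc_def is_gauge_of_def
    using mtcD mtcD' gtD U.F_unitary U.R_unitary U.qdim_pos by blast
  define t where "t = (\<Sum>a\<in>UNIV. (Re (qdim C a))\<^sup>2)"
  have "0 < t" unfolding t_def using pos(2) by (intro sum_pos) (auto simp: less_imp_neq[symmetric])
  moreover have "(\<Sum>a\<in>UNIV. (qdim ?D a)\<^sup>2) = of_real t"
  proof -
    have "qdim C a = of_real (Re (qdim C a))" for a using pos(1)[of a] by (simp add: of_real_Re)
    then have "(qdim ?D a)\<^sup>2 = of_real ((Re (qdim C a))\<^sup>2)" for a unfolding qdimD by (metis of_real_power)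
    then show ?thesis by (simp only: t_def of_real_sum)
  qed
  moreover have "(complex_of_real (sqrt t))\<^sup>2 = of_real t"
    using \<open>0 < t\<close> by (simp only: of_real_power[symmetric]) simp
  ultimately have "unitary_tqft ?D (of_real (sqrt t))"
    unfolding unitary_tqft_def tqft_def using mtcD unitary by simp
  then show ?thesis using unitary by blast
qed

end
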